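(* Let $n\ge1$ and $\lambda\in\mathcal{P}(n)$. Then $$\mathrm{mult}_{\mathbf S}(\mu[\lambda])=\sum_{\tau\in\mathcal{ST}(\lambda)}N_\tau,$$ where $\mathcal{ST}(\lambda)$ denotes the set of spin tableaux of shape $\lambda$.
   Context: Let $\mathfrak{g}=\mathfrak{sl}(n,\mathbb{C})$, $\mathfrak{t}$ the Cartan subalgebra of diagonal matrices, $\epsilon_i\in\mathfrak{t}^*$ the functional $\mathrm{diag}(t_1,\ldots,t_n)\mapsto t_i$, $\Phi^+=\{\epsilon_i-\epsilon_j:1\le i<j\le n\}$, and $\varpi_i=\epsilon_1+\cdots+\epsilon_i$ for $1\le i\le n-1$. Here the Levi subalgebra is $\mathfrak{h}=\mathfrak{t}$, and the spin module is $\mathbf{S}=\bigwedge\mathfrak{u}^+$ with $\mathfrak{u}^+=\bigoplus_{\alpha\in\Phi^+}\mathfrak{g}_\alpha$, on which $\mathfrak{t}$ acts through $\mathfrak{t}\xrightarrow{\mathrm{ad}}\mathfrak{so}(\mathfrak q)\subset\mathbf C(\mathfrak q)\to\mathrm{End}(\mathbf S)$ (Clifford multiplication), $\mathfrak q$ being the orthogonal complement of $\mathfrak t$ for the Killing form. Its weights are $\mu(A)=\frac12\big(\sum_{\alpha\in\Phi^+\setminus A}\alpha-\sum_{\alpha\in A}\alpha\big)$, $A\subset\Phi^+$, and $\mathrm{mult}_{\mathbf S}(\mu)=\#\{A\subset\Phi^+:\mu(A)=\mu\}$ for $\mu\in\mathfrak t^*$. $\mathcal{P}(n)$ is the set of sequences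 of nonnegative integers $\lambda=(\lambda_1\ge\cdots\ge\lambda_n)$ with $\lambda_1+\cdots+\lambda_n=\binom n2$ and $\lambda_1+\cdots+\lambda_i\le(n-1)+\cdots+(n-i)$ for all $i\in\{1,\ldots,n\}$. For such $\lambda$, $\mu[\lambda]=(\lambda_1-\lambda_2)\varpi_1+\cdots+(\lambda_{n-1}-\lambda_n)\varpi_{n-1}$. A spin tableau of shape $\lambda\in\mathcal P(n)$ is a filling $\tau$ of the boxes of the Young diagram $\lambda$ (rows of lengths $\lambda_1,\ldots,\lambda_n$ from top to bottom, left-justified) with entries in $\{1,\dots,n-1\}$ such that: - for every $i\in\{1,\ldots,n-1\}$, $\tau$ contains exactly $i$ boxes of entry $i$, all located within the first $i+1$ rows; - the rows of $\tau$ are nondecreasing from left to right and the columns are nondecreasing from top to bottom; moreover, in the $i$-th row, the entries $\ge i$ are (strictly) increasing. For a spin tableau $\tau$, $N_\tau$ is the product of the binomial coefficients $\binom{a_{i,j}}{b_{i,j}}$ over all pairs $(i,j)$ such that the number $i$ occurs in the $j$-th column of $\tau$, where $b_{i,j}$ is the number of boxes of entry $i$ within the first (topmost) $i$ boxes of the $j$-th column, and $a_{i,j}=b_{i,j}+\#\{$boxes of entry $<i$ in the $j$-th column whose right neighbor, if any, has entry $>i\}$ (boxes with no right neighbor are counted). For $n=1$, $\lambda=(0)$, the only spin tableau is the empty one, with $N_\emptyset=1$. *)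

theory Defs
  imports "Jordan_Normal_Form.Matrix" "HOL-Library.Function_Algebras"
begin

section \<open>The Lie algebra and its Cartan subalgebra\<close>

text \<open>
  Library matrices have rows and columns numbered from 0, so \<open>H $$ (k, k)\<close> is the value of
  \<open>\<epsilon>\<close> with index \<open>k + 1\<close> on the diagonal matrix \<open>H\<close>.
\<close>

definition sl :: "nat \<Rightarrow> complex mat set" where
  "sl n = {X \<in> carrier_mat n n. (\<Sum>i<n. X $$ (i, i)) = 0}"

definition cartan :: "nat \<Rightarrow> complex mat set" where
  "cartan n = {H \<in> sl n. diagonal_mat H}"

definition ad :: "complex mat \<Rightarrow> complex mat \<Rightarrow> complex mat" where
  "ad X Y = X * Y - Y * X"

definition unit_mat :: "nat \<Rightarrow> nat \<Rightarrow> nat \<Rightarrow> complex mat" where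
  "unit_mat n i j = mat n n (\<lambda>(k, l). if k = i \<and> l = j then 1 else 0)"

text \<open>
  The trace of \<open>ad X \<circ> ad Y\<close> is taken on the space of all matrices, in the basis of matrix units.
  Its image is contained in \<open>sl n\<close>, so the trace on \<open>sl n\<close> is the same.
\<close>

definition killing :: "nat \<Rightarrow> complex mat \<Rightarrow> complex mat \<Rightarrow> complex" where
  "killing n X Y = (\<Sum>i<n. \<Sum>j<n. ad X (ad Y (unit_mat n i j)) $$ (i, j))"

definition cartan_perp :: "nat \<Rightarrow> complex mat set" where
  "cartan_perp n = {X \<in> sl n. \<forall>H\<in>cartan n. killing n X H = 0}"

text \<open>
  The pair \<open>(i, j)\<close> stands for the positive root \<open>\<alpha>\<close> sending \<open>H\<close> to
  \<open>H $$ (i, i) - H $$ (j, j)\<close>; its root space is spanned by \<open>unit_mat n i j\<close>.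
\<close>

definition pos_roots :: "nat \<Rightarrow> (nat \<times> nat) set" where
  "pos_roots n = {(i, j). i < j \<and> j < n}"

definition root_val :: "nat \<times> nat \<Rightarrow> complex mat \<Rightarrow> complex" where
  "root_val \<alpha> H = H $$ (fst \<alpha>, fst \<alpha>) - H $$ (snd \<alpha>, snd \<alpha>)"

definition fund_weight :: "nat \<Rightarrow> complex mat \<Rightarrow> complex" where
  "fund_weight i H = (\<Sum>k<i. H $$ (k, k))"


section \<open>The spin module\<close>

text \<open>
  The exterior algebra of the sum of the positive root spaces: the function \<open>s\<close> stands for the sum
  of \<open>s A\<close> times the wedge product, in lexicographic order, of the root vectors
  \<open>unit_mat n i j\<close> with \<open>(i, j) \<in> A\<close>.
\<close>

type_synonym spinor = "(nat \<times> nat) set \<Rightarrow> complex"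

definition spinors :: "nat \<Rightarrow> spinor set" where
  "spinors n = {s. \<forall>A. \<not> A \<subseteq> pos_roots n \<longrightarrow> s A = 0}"

definition spinor_scale :: "complex \<Rightarrow> spinor \<Rightarrow> spinor" where
  "spinor_scale c s = (\<lambda>A. c * s A)"

definition wedge_sign :: "nat \<times> nat \<Rightarrow> (nat \<times> nat) set \<Rightarrow> complex" where
  "wedge_sign \<alpha> A = (- 1) ^ card {\<beta> \<in> A. (\<beta>, \<alpha>) \<in> less_than <*lex*> less_than}"

definition wedge :: "nat \<times> nat \<Rightarrow> spinor \<Rightarrow> spinor" where
  "wedge \<alpha> s = (\<lambda>A. if \<alpha> \<in> A then wedge_sign \<alpha> A * s (A - {\<alpha>}) else 0)"

definition contract :: "nat \<times> nat \<Rightarrow> spinor \<Rightarrow> spinor" where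
  "contract \<alpha> s = (\<lambda>A. if \<alpha> \<notin> A then wedge_sign \<alpha> A * s (insert \<alpha> A) else 0)"

text \<open>
  Clifford multiplication by \<open>x\<close> in \<open>cartan_perp n\<close>, with the convention that the square of \<open>x\<close> is
  \<open>killing n x x\<close>: exterior multiplication by the strictly upper triangular part of \<open>x\<close> plus
  contraction with the linear form \<open>y \<mapsto> 2 * killing n x y\<close>, to which only the strictly lower
  triangular part of \<open>x\<close> contributes.
\<close>

definition clifford :: "nat \<Rightarrow> complex mat \<Rightarrow> spinor \<Rightarrow> spinor" where
  "clifford n x s =
     (\<Sum>\<alpha>\<in>pos_roots n. spinor_scale (x $$ \<alpha>) (wedge \<alpha> s)
        + spinor_scale (2 * killing n x (unit_mat n (fst \<alpha>) (snd \<alpha>))) (contract \<alpha> s))"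

text \<open>
  A skew-symmetric endomorphism \<open>T\<close> of \<open>cartan_perp n\<close> corresponds to the element of the Clifford
  algebra equal to one quarter of the sum of the products of \<open>T b\<close> and \<open>b'\<close>, where \<open>b\<close> runs over a
  basis and \<open>b'\<close> over the dual basis for the Killing form.  (Its commutator with any \<open>x\<close> is \<open>T x\<close>.)
  The basis used here consists of the matrix units off the diagonal; the dual of
  \<open>unit_mat n i j\<close> is a multiple of \<open>unit_mat n j i\<close>.
\<close>

definition spin_so :: "nat \<Rightarrow> (complex mat \<Rightarrow> complex mat) \<Rightarrow> spinor \<Rightarrow> spinor" where
  "spin_so n T s =
     (\<Sum>(i, j)\<in>{(i, j). i < n \<and> j < n \<and> i \<noteq> j}.
        spinor_scale (1 / (4 * killing n (unit_mat n i j) (unit_mat n j i)))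
          (clifford n (T (unit_mat n i j)) (clifford n (unit_mat n j i) s)))"

definition spin_act :: "nat \<Rightarrow> complex mat \<Rightarrow> spinor \<Rightarrow> spinor" where
  "spin_act n H = spin_so n (ad H)"

definition weight_space :: "nat \<Rightarrow> (complex mat \<Rightarrow> complex) \<Rightarrow> spinor set" where
  "weight_space n \<mu> =
     {s \<in> spinors n. \<forall>H\<in>cartan n. spin_act n H s = spinor_scale (\<mu> H) s}"

definition spin_mult :: "nat \<Rightarrow> (complex mat \<Rightarrow> complex) \<Rightarrow> nat" where
  "spin_mult n \<mu> = vector_space.dim spinor_scale (weight_space n \<mu>)"


section \<open>Partitions and spin tableaux\<close>

text \<open>
  Rows, columns and parts are numbered from 1.  A sequence is a function vanishing outside
  \<open>{1..n}\<close>, and a filling is a function vanishing outside the diagram, so that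
  both are determined by the values that matter.
\<close>

definition spin_partitions :: "nat \<Rightarrow> (nat \<Rightarrow> nat) set" where
  "spin_partitions n =
     {l. (\<forall>i. i \<notin> {1..n} \<longrightarrow> l i = 0)
       \<and> (\<forall>i j. 1 \<le> i \<and> i \<le> j \<and> j \<le> n \<longrightarrow> l j \<le> l i)
       \<and> (\<Sum>i=1..n. l i) = n choose 2
       \<and> (\<forall>i\<in>{1..n}. (\<Sum>k=1..i. l k) \<le> (\<Sum>k=1..i. n - k))}"

definition part_weight :: "nat \<Rightarrow> (nat \<Rightarrow> nat) \<Rightarrow> complex mat \<Rightarrow> complex" where
  "part_weight n l H =
     (\<Sum>i=1..n - 1. (of_nat (l i) - of_nat (l (i + 1))) * fund_weight i H)"

definition boxes :: "nat \<Rightarrow> (nat \<Rightarrow> nat) \<Rightarrow> (nat \<times> nat) set" where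
  "boxes n l = {(r, c). r \<in> {1..n} \<and> c \<in> {1..l r}}"

definition spin_tableaux :: "nat \<Rightarrow> (nat \<Rightarrow> nat) \<Rightarrow> (nat \<times> nat \<Rightarrow> nat) set" where
  "spin_tableaux n l =
     {t. (\<forall>b. b \<notin> boxes n l \<longrightarrow> t b = 0)
       \<and> (\<forall>b\<in>boxes n l. t b \<in> {1..n - 1})
       \<and> (\<forall>i\<in>{1..n - 1}. card {b \<in> boxes n l. t b = i} = i
            \<and> (\<forall>r c. (r, c) \<in> boxes n l \<and> t (r, c) = i \<longrightarrow> r \<le> i + 1))
       \<and> (\<forall>r c c'. (r, c) \<in> boxes n l \<and> (r, c') \<in> boxes n l \<and> c < c'
            \<longrightarrow> t (r, c) \<le> t (r, c'))
       \<and> (\<forall>r r' c. (r, c) \<in> boxes n l \<and> (r', c) \<in> boxes n l \<and> r < r'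
            \<longrightarrow> t (r, c) \<le> t (r', c))
       \<and> (\<forall>r c c'. (r, c) \<in> boxes n l \<and> (r, c') \<in> boxes n l \<and> c < c'
            \<and> r \<le> t (r, c) \<and> r \<le> t (r, c') \<longrightarrow> t (r, c) < t (r, c'))}"

definition tab_b :: "nat \<Rightarrow> (nat \<Rightarrow> nat) \<Rightarrow> (nat \<times> nat \<Rightarrow> nat) \<Rightarrow> nat \<Rightarrow> nat \<Rightarrow> nat" where
  "tab_b n l t i j = card {r. r \<le> i \<and> (r, j) \<in> boxes n l \<and> t (r, j) = i}"

definition tab_a :: "nat \<Rightarrow> (nat \<Rightarrow> nat) \<Rightarrow> (nat \<times> nat \<Rightarrow> nat) \<Rightarrow> nat \<Rightarrow> nat \<Rightarrow> nat" where
  "tab_a n l t i j = tab_b n l t i j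
     + card {r. (r, j) \<in> boxes n l \<and> t (r, j) < i
              \<and> ((r, j + 1) \<in> boxes n l \<longrightarrow> t (r, j + 1) > i)}"

definition tab_N :: "nat \<Rightarrow> (nat \<Rightarrow> nat) \<Rightarrow> (nat \<times> nat \<Rightarrow> nat) \<Rightarrow> nat" where
  "tab_N n l t =
     (\<Prod>(i, j)\<in>{(i, j). \<exists>r. (r, j) \<in> boxes n l \<and> t (r, j) = i}.
        tab_a n l t i j choose tab_b n l t i j)"



section \<open>The Clifford relation and the weights of the spin module\<close>

lemma finite_pos_roots: "finite (pos_roots n)"
  by (rule finite_subset[of _ "{..<n} \<times> {..<n}"]) (auto simp: pos_roots_def)

lemma sum_fun_apply: "(\<Sum>x\<in>X. f x) a = (\<Sum>x\<in>X. f x a)"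
  by (induction X rule: infinite_finite_induct) auto

lemma unit_mat_carrier [simp]: "unit_mat n i j \<in> carrier_mat n n"
  by (simp add: unit_mat_def)

lemma killing_eq:
  assumes "X \<in> carrier_mat n n" and "Y \<in> carrier_mat n n"
  shows "killing n X Y = 2 * of_nat n * (\<Sum>i<n. \<Sum>j<n. X $$ (i, j) * Y $$ (j, i))
           - 2 * (\<Sum>i<n. X $$ (i, i)) * (\<Sum>i<n. Y $$ (i, i))"
proof -
  define P where "P i = (\<Sum>k<n. X $$ (i, k) * Y $$ (k, i))" for i
  define Q where "Q i = (\<Sum>k<n. Y $$ (i, k) * X $$ (k, i))" for i
  have unit: "unit_mat n i j $$ (k, l) = (if k = i \<and> l = j then 1 else 0)"
    if "k < n" "l < n" for i j k l
    using that by (simp add: unit_mat_def)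
  have entry: "ad X (ad Y (unit_mat n i j)) $$ (i, j)
      = P i - X $$ (i, i) * Y $$ (j, j) - (Y $$ (i, i) * X $$ (j, j) - Q j)"
    if i: "i < n" and j: "j < n" for i j
  proof -
    let ?E = "unit_mat n i j"
    have YE: "(Y * ?E) $$ (k, l) = (if l = j then Y $$ (k, i) else 0)"
      if "k < n" "l < n" for k l
    proof -
      have "(Y * ?E) $$ (k, l) = (\<Sum>m = 0..<n. Y $$ (k, m) * ?E $$ (m, l))"
        using assms that by (simp add: scalar_prod_def unit_mat_def)
      also have "\<dots> = (\<Sum>m = 0..<n. if m = i then (if l = j then Y $$ (k, i) else 0) else 0)"
        by (rule sum.cong) (use that in \<open>auto simp: unit\<close>)
      finally show ?thesis using i by simp
    qed
    have EY: "(?E * Y) $$ (k, l) = (if k = i then Y $$ (j, l) else 0)"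
      if "k < n" "l < n" for k l
    proof -
      have "(?E * Y) $$ (k, l) = (\<Sum>m = 0..<n. ?E $$ (k, m) * Y $$ (m, l))"
        using assms that by (simp add: scalar_prod_def unit_mat_def)
      also have "\<dots> = (\<Sum>m = 0..<n. if m = j then (if k = i then Y $$ (j, l) else 0) else 0)"
        by (rule sum.cong) (use that in \<open>auto simp: unit\<close>)
      finally show ?thesis using j by simp
    qed
    define Z where "Z = ad Y ?E"
    have Zc: "Z \<in> carrier_mat n n"
      unfolding Z_def ad_def using assms by (auto intro!: minus_carrier_mat mult_carrier_mat)
    have Z: "Z $$ (k, l) = (if l = j then Y $$ (k, i) else 0) - (if k = i then Y $$ (j, l) else 0)"
      if "k < n" "l < n" for k l
    proof -
      have "Z $$ (k, l) = (Y * ?E) $$ (k, l) - (?E * Y) $$ (k, l)"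
        unfolding Z_def ad_def by (rule index_minus_mat) (use assms that in auto, simp_all add: unit_mat_def that)
      then show ?thesis using YE EY that by simp
    qed
    have "ad X Z $$ (i, j) = (X * Z) $$ (i, j) - (Z * X) $$ (i, j)"
      unfolding ad_def by (rule index_minus_mat) (use assms Zc i j in auto)
    also have "(X * Z) $$ (i, j) = (\<Sum>m = 0..<n. X $$ (i, m) * Z $$ (m, j))"
      using assms Zc i j by (simp add: scalar_prod_def)
    also have "\<dots> = (\<Sum>m = 0..<n. X $$ (i, m) * Y $$ (m, i) - (if m = i then X $$ (i, i) * Y $$ (j, j) else 0))"
      by (rule sum.cong) (use j in \<open>auto simp: Z algebra_simps\<close>)
    also have "\<dots> = P i - X $$ (i, i) * Y $$ (j, j)"
      using i by (simp add: sum_subtractf P_def atLeast0LessThan)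
    also have "(Z * X) $$ (i, j) = (\<Sum>m = 0..<n. Z $$ (i, m) * X $$ (m, j))"
      using assms Zc i j by (simp add: scalar_prod_def)
    also have "\<dots> = (\<Sum>m = 0..<n. (if m = j then Y $$ (i, i) * X $$ (j, j) else 0) - Y $$ (j, m) * X $$ (m, j))"
      by (rule sum.cong) (use i in \<open>auto simp: Z algebra_simps\<close>)
    also have "\<dots> = Y $$ (i, i) * X $$ (j, j) - Q j"
      using j by (simp add: sum_subtractf Q_def atLeast0LessThan)
    finally show ?thesis by (simp add: Z_def)
  qed
  have PQ: "(\<Sum>i<n. Q i) = (\<Sum>i<n. P i)"
    unfolding P_def Q_def by (subst sum.swap) (simp add: mult.commute)
  have "killing n X Y = (\<Sum>i<n. \<Sum>j<n. P i - X $$ (i, i) * Y $$ (j, j) - (Y $$ (i, i) * X $$ (j, j) - Q j))"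
    unfolding killing_def by (intro sum.cong refl) (simp add: entry)
  also have "\<dots> = of_nat n * (\<Sum>i<n. P i) + of_nat n * (\<Sum>i<n. Q i)
      - (\<Sum>i<n. X $$ (i, i)) * (\<Sum>i<n. Y $$ (i, i)) - (\<Sum>i<n. Y $$ (i, i)) * (\<Sum>i<n. X $$ (i, i))"
    unfolding sum_product by (simp add: sum_subtractf sum.distrib flip: sum_distrib_left)
  finally show ?thesis using PQ by (simp add: P_def algebra_simps)
qed

lemma killing_unit:
  assumes "X \<in> carrier_mat n n" "i < n" "j < n" "i \<noteq> j"
  shows "killing n X (unit_mat n i j) = 2 * of_nat n * X $$ (j, i)"
proof -
  have tr: "(\<Sum>k<n. unit_mat n i j $$ (k, k)) = 0"
    using assms by (intro sum.neutral) (auto simp: unit_mat_def)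
  have "(\<Sum>k<n. \<Sum>l<n. X $$ (k, l) * unit_mat n i j $$ (l, k))
      = (\<Sum>k<n. \<Sum>l<n. if l = i then (if k = j then X $$ (j, i) else 0) else 0)"
    by (intro sum.cong refl) (auto simp: unit_mat_def)
  also have "\<dots> = X $$ (j, i)" using assms by simp
  finally show ?thesis using assms tr by (simp add: killing_eq)
qed

lemma cartan_perp_diag:
  assumes X: "X \<in> cartan_perp n" and i: "i < n"
  shows "X $$ (i, i) = 0"
proof -
  have c: "X \<in> carrier_mat n n" and tr: "(\<Sum>k<n. X $$ (k, k)) = 0"
    using X by (auto simp: cartan_perp_def sl_def)
  have eq: "X $$ (k, k) = X $$ (i, i)" if k: "k < n" for k
  proof (cases "k = i")
    case False
    define H where "H = mat n n (\<lambda>(a, b). if a = b then (if a = k then 1 else if a = i then - 1 else 0) else (0 :: complex))"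
    have H: "H \<in> cartan n"
    proof -
      have "(\<Sum>a<n. H $$ (a, a)) = (\<Sum>a<n. (if a = k then 1 else 0) - (if a = i then 1 else 0))"
        by (rule sum.cong) (use False in \<open>auto simp: H_def\<close>)
      also have "\<dots> = 0" using k i by (simp add: sum_subtractf)
      finally show ?thesis by (auto simp: cartan_def sl_def diagonal_mat_def H_def)
    qed
    have "0 = killing n X H" using X H by (simp add: cartan_perp_def)
    also have "\<dots> = 2 * of_nat n * (\<Sum>a<n. \<Sum>b<n. X $$ (a, b) * H $$ (b, a))"
      using c tr by (simp add: killing_eq H_def)
    also have "(\<Sum>a<n. \<Sum>b<n. X $$ (a, b) * H $$ (b, a))
       = (\<Sum>a<n. \<Sum>b<n. if b = a then (if a = k then X $$ (k, k) else 0) - (if a = i then X $$ (i, i) else 0) else 0)"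
      by (intro sum.cong refl) (use False in \<open>auto simp: H_def\<close>)
    also have "\<dots> = X $$ (k, k) - X $$ (i, i)"
      using k i by (simp add: sum_subtractf)
    finally show ?thesis using i by simp
  qed simp
  have "(\<Sum>k<n. X $$ (k, k)) = (\<Sum>k<n. X $$ (i, i))"
    by (rule sum.cong) (use eq in auto)
  then show ?thesis using tr i by simp
qed

lemma wedge_sign_remove: 
  assumes "finite A"
  shows "wedge_sign \<alpha> (A - {\<beta>}) = (if \<beta> \<in> A \<and> (\<beta>, \<alpha>) \<in> less_than <*lex*> less_than then - wedge_sign \<alpha> A else wedge_sign \<alpha> A)"
proof (cases "\<beta> \<in> A \<and> (\<beta>, \<alpha>) \<in> less_than <*lex*> less_than")
  case True
  let ?R = "less_than <*lex*> less_than"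
  have "{\<gamma> \<in> A. (\<gamma>, \<alpha>) \<in> ?R} = insert \<beta> {\<gamma> \<in> A - {\<beta>}. (\<gamma>, \<alpha>) \<in> ?R}"
    using True by blast
  then have "card {\<gamma> \<in> A. (\<gamma>, \<alpha>) \<in> ?R} = Suc (card {\<gamma> \<in> A - {\<beta>}. (\<gamma>, \<alpha>) \<in> ?R})"
    using assms by simp
  then show ?thesis using True unfolding wedge_sign_def by simp
next
  case False
  then have "{\<gamma> \<in> A - {\<beta>}. (\<gamma>, \<alpha>) \<in> less_than <*lex*> less_than} = {\<gamma> \<in> A. (\<gamma>, \<alpha>) \<in> less_than <*lex*> less_than}"
    by auto
  then show ?thesis using False by (simp add: wedge_sign_def)
qed

lemma wedge_sign_insert:
  assumes "finite A" "\<beta> \<notin> A"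
  shows "wedge_sign \<alpha> (insert \<beta> A) = (if (\<beta>, \<alpha>) \<in> less_than <*lex*> less_than then - wedge_sign \<alpha> A else wedge_sign \<alpha> A)"
  using wedge_sign_remove[of "insert \<beta> A" \<alpha> \<beta>] assms by (auto split: if_splits)

lemma wedge_sign_sq [simp]: "wedge_sign \<alpha> A * wedge_sign \<alpha> A = 1"
  by (simp add: wedge_sign_def flip: power_mult_distrib)

lemma lex_asym: "((\<beta>, \<alpha>) \<in> less_than <*lex*> less_than) = (\<beta> \<noteq> \<alpha> \<and> (\<alpha>, \<beta>) \<notin> less_than <*lex*> less_than)"
  for \<alpha> \<beta> :: "nat \<times> nat"
  by (cases \<alpha>; cases \<beta>) auto

lemma lex_irrefl [simp]: "(\<alpha>, \<alpha>) \<notin> less_than <*lex*> less_than" for \<alpha> :: "nat \<times> nat"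
  by (cases \<alpha>) auto

lemma wedge_wedge:
  assumes "finite A"
  shows "wedge \<alpha> (wedge \<beta> s) A + wedge \<beta> (wedge \<alpha> s) A = 0"
proof (cases "\<alpha> \<in> A \<and> \<beta> \<in> A \<and> \<alpha> \<noteq> \<beta>")
  case True
  moreover have "A - {\<alpha>} - {\<beta>} = A - {\<beta>} - {\<alpha>}" by blast
  ultimately show ?thesis
    using assms lex_asym[of \<alpha> \<beta>] by (auto simp: wedge_def wedge_sign_remove)
qed (auto simp: wedge_def)

lemma contract_contract:
  assumes "finite A"
  shows "contract \<alpha> (contract \<beta> s) A + contract \<beta> (contract \<alpha> s) A = 0"
proof (cases "\<alpha> \<notin> A \<and> \<beta> \<notin> A \<and> \<alpha> \<noteq> \<beta>")
  case True
  then show ?thesis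
    using assms lex_asym[of \<alpha> \<beta>] by (auto simp: contract_def wedge_sign_insert insert_commute)
qed (auto simp: contract_def)

lemma wedge_contract:
  assumes "finite A"
  shows "wedge \<alpha> (contract \<beta> s) A + contract \<beta> (wedge \<alpha> s) A = (if \<alpha> = \<beta> then s A else 0)"
proof (cases "\<alpha> = \<beta>")
  case True
  then show ?thesis using assms
    by (auto simp: wedge_def contract_def wedge_sign_remove wedge_sign_insert insert_absorb
        simp flip: mult.assoc)
next
  case neq: False
  show ?thesis
  proof (cases "\<alpha> \<in> A \<and> \<beta> \<notin> A")
    case True
    moreover have "insert \<beta> (A - {\<alpha>}) = insert \<beta> A - {\<alpha>}" using neq by blast
    ultimately show ?thesis using neq assms lex_asym[of \<alpha> \<beta>]
      by (simp add: wedge_def contract_def wedge_sign_remove wedge_sign_insert)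
  qed (use neq in \<open>auto simp: wedge_def contract_def\<close>)
qed

lemma wedge_linear:
  "wedge \<alpha> (s + s') = wedge \<alpha> s + wedge \<alpha> s'"
  "wedge \<alpha> (spinor_scale c s) = spinor_scale c (wedge \<alpha> s)"
  "wedge \<alpha> 0 = 0"
  by (auto simp: wedge_def spinor_scale_def fun_eq_iff algebra_simps)

lemma contract_linear:
  "contract \<alpha> (s + s') = contract \<alpha> s + contract \<alpha> s'"
  "contract \<alpha> (spinor_scale c s) = spinor_scale c (contract \<alpha> s)"
  "contract \<alpha> 0 = 0"
  by (auto simp: contract_def spinor_scale_def fun_eq_iff algebra_simps)

lemma wedge_sum: "wedge \<alpha> (\<Sum>x\<in>X. f x) = (\<Sum>x\<in>X. wedge \<alpha> (f x))"
  by (induction X rule: infinite_finite_induct) (simp_all only: wedge_linear sum.infinite sum.empty sum.insert not_False_eq_True)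

lemma contract_sum: "contract \<alpha> (\<Sum>x\<in>X. f x) = (\<Sum>x\<in>X. contract \<alpha> (f x))"
  by (induction X rule: infinite_finite_induct) (simp_all only: contract_linear sum.infinite sum.empty sum.insert not_False_eq_True)

lemma clifford_apply:
  "clifford n x s A = (\<Sum>\<alpha>\<in>pos_roots n. x $$ \<alpha> * wedge \<alpha> s A
     + 2 * killing n x (unit_mat n (fst \<alpha>) (snd \<alpha>)) * contract \<alpha> s A)"
  unfolding clifford_def sum_fun_apply plus_fun_apply spinor_scale_def ..

lemma wedge_clifford:
  "wedge \<alpha> (clifford n x s) A = (\<Sum>\<beta>\<in>pos_roots n. x $$ \<beta> * wedge \<alpha> (wedge \<beta> s) A
     + 2 * killing n x (unit_mat n (fst \<beta>) (snd \<beta>)) * wedge \<alpha> (contract \<beta> s) A)"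
  unfolding clifford_def wedge_sum wedge_linear
  unfolding sum_fun_apply plus_fun_apply spinor_scale_def ..

lemma contract_clifford:
  "contract \<alpha> (clifford n x s) A = (\<Sum>\<beta>\<in>pos_roots n. x $$ \<beta> * contract \<alpha> (wedge \<beta> s) A
     + 2 * killing n x (unit_mat n (fst \<beta>) (snd \<beta>)) * contract \<alpha> (contract \<beta> s) A)"
  unfolding clifford_def contract_sum contract_linear
  unfolding sum_fun_apply plus_fun_apply spinor_scale_def ..

lemma clifford_clifford:
  assumes "finite A"
  shows "clifford n x (clifford n y s) A + clifford n y (clifford n x s) A =
     (\<Sum>\<alpha>\<in>pos_roots n. 2 * (x $$ \<alpha> * killing n y (unit_mat n (fst \<alpha>) (snd \<alpha>))
       + y $$ \<alpha> * killing n x (unit_mat n (fst \<alpha>) (snd \<alpha>)))) * s A"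
proof -
  let ?R = "pos_roots n"
  define k where "k x \<alpha> = 2 * killing n x (unit_mat n (fst \<alpha>) (snd \<alpha>))" for x \<alpha>
  define T where "T x y \<alpha> \<beta> =
      x $$ \<alpha> * (y $$ \<beta> * wedge \<alpha> (wedge \<beta> s) A + k y \<beta> * wedge \<alpha> (contract \<beta> s) A)
    + k x \<alpha> * (y $$ \<beta> * contract \<alpha> (wedge \<beta> s) A + k y \<beta> * contract \<alpha> (contract \<beta> s) A)"
    for x y \<alpha> \<beta>
  have cc: "clifford n x (clifford n y s) A = (\<Sum>\<alpha>\<in>?R. \<Sum>\<beta>\<in>?R. T x y \<alpha> \<beta>)" for x y
    unfolding clifford_apply[of n x] wedge_clifford contract_clifford k_def[symmetric] T_def
      sum_distrib_left sum.distrib[symmetric] ..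
  have T: "T x y \<alpha> \<beta> + T y x \<beta> \<alpha>
      = (if \<beta> = \<alpha> then (x $$ \<alpha> * k y \<alpha> + y $$ \<alpha> * k x \<alpha>) * s A else 0)" for \<alpha> \<beta>
  proof -
    have 1: "wedge \<alpha> (wedge \<beta> s) A = - wedge \<beta> (wedge \<alpha> s) A"
      using wedge_wedge[OF assms] by (rule eq_neg_iff_add_eq_0[THEN iffD2])
    have 2: "contract \<alpha> (contract \<beta> s) A = - contract \<beta> (contract \<alpha> s) A"
      using contract_contract[OF assms] by (rule eq_neg_iff_add_eq_0[THEN iffD2])
    have 3: "wedge \<alpha> (contract \<beta> s) A = (if \<alpha> = \<beta> then s A else 0) - contract \<beta> (wedge \<alpha> s) A"
      using wedge_contract[OF assms] by (rule eq_diff_eq[THEN iffD2])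
    have 4: "wedge \<beta> (contract \<alpha> s) A = (if \<beta> = \<alpha> then s A else 0) - contract \<alpha> (wedge \<beta> s) A"
      using wedge_contract[OF assms] by (rule eq_diff_eq[THEN iffD2])
    show ?thesis unfolding T_def 1 2 3 4 by (cases "\<beta> = \<alpha>") (simp_all add: algebra_simps)
  qed
  have "clifford n x (clifford n y s) A + clifford n y (clifford n x s) A
      = (\<Sum>\<alpha>\<in>?R. \<Sum>\<beta>\<in>?R. T x y \<alpha> \<beta>) + (\<Sum>\<alpha>\<in>?R. \<Sum>\<beta>\<in>?R. T y x \<beta> \<alpha>)"
    unfolding cc by (rule arg_cong[where f = "\<lambda>z. _ + z"]) (rule sum.swap)
  also have "\<dots> = (\<Sum>\<alpha>\<in>?R. (x $$ \<alpha> * k y \<alpha> + y $$ \<alpha> * k x \<alpha>) * s A)"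
    unfolding sum.distrib[symmetric] T using finite_pos_roots[of n] by simp
  also have "\<dots> = (\<Sum>\<alpha>\<in>?R. x $$ \<alpha> * k y \<alpha> + y $$ \<alpha> * k x \<alpha>) * s A"
    by (rule sum_distrib_right[symmetric])
  also have "(\<Sum>\<alpha>\<in>?R. x $$ \<alpha> * k y \<alpha> + y $$ \<alpha> * k x \<alpha>)
     = (\<Sum>\<alpha>\<in>?R. 2 * (x $$ \<alpha> * killing n y (unit_mat n (fst \<alpha>) (snd \<alpha>))
       + y $$ \<alpha> * killing n x (unit_mat n (fst \<alpha>) (snd \<alpha>))))"
    by (rule sum.cong) (simp_all add: k_def algebra_simps)
  finally show ?thesis .
qed

lemma sum_offdiag:
  fixes f :: "nat \<times> nat \<Rightarrow> 'a :: comm_monoid_add"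
  shows "(\<Sum>\<alpha>\<in>{(i, j). i < n \<and> j < n \<and> i \<noteq> j}. f \<alpha>)
    = (\<Sum>\<alpha>\<in>pos_roots n. f \<alpha> + f (snd \<alpha>, fst \<alpha>))"
proof -
  let ?sw = "\<lambda>\<alpha> :: nat \<times> nat. (snd \<alpha>, fst \<alpha>)"
  have split: "{(i, j). i < n \<and> j < n \<and> i \<noteq> j} = pos_roots n \<union> ?sw ` pos_roots n"
    by (auto simp: pos_roots_def image_iff)
  have "inj_on ?sw (pos_roots n)" by (auto intro: inj_onI)
  moreover have "pos_roots n \<inter> ?sw ` pos_roots n = {}" by (auto simp: pos_roots_def)
  ultimately show ?thesis
    unfolding split using finite_pos_roots[of n]
    by (subst sum.union_disjoint) (auto simp: sum.reindex sum.distrib)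
qed

lemma clifford_stable:
  assumes t: "t \<in> spinors n"
  shows "clifford n y t \<in> spinors n"
proof -
  have "clifford n y t B = 0" if B: "\<not> B \<subseteq> pos_roots n" for B
  proof -
    have "wedge \<alpha> t B = 0 \<and> contract \<alpha> t B = 0" if "\<alpha> \<in> pos_roots n" for \<alpha>
    proof -
      have "\<not> B - {\<alpha>} \<subseteq> pos_roots n" "\<not> insert \<alpha> B \<subseteq> pos_roots n"
        using B that by auto
      then show ?thesis using t by (auto simp: wedge_def contract_def spinors_def)
    qed
    then show ?thesis by (simp add: clifford_def sum_fun_apply spinor_scale_def)
  qed
  then show ?thesis by (simp add: spinors_def)
qed

theorem clifford_sq:
  assumes x: "x \<in> cartan_perp n" and s: "s \<in> spinors n"
  shows "clifford n x (clifford n x s) = spinor_scale (killing n x x) s"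
proof
  fix A
  have c: "x \<in> carrier_mat n n" and tr: "(\<Sum>k<n. x $$ (k, k)) = 0"
    using x by (auto simp: cartan_perp_def sl_def)
  show "clifford n x (clifford n x s) A = spinor_scale (killing n x x) s A"
  proof (cases "A \<subseteq> pos_roots n")
    case True
    then have fin: "finite A" using finite_pos_roots finite_subset by blast
    have "(\<Sum>i<n. \<Sum>j<n. x $$ (i, j) * x $$ (j, i))
        = (\<Sum>(i, j)\<in>{..<n} \<times> {..<n}. x $$ (i, j) * x $$ (j, i))"
      by (simp add: sum.cartesian_product)
    also have "\<dots> = (\<Sum>(i, j)\<in>{(i, j). i < n \<and> j < n \<and> i \<noteq> j}. x $$ (i, j) * x $$ (j, i))"
      by (rule sum.mono_neutral_right) (auto simp: cartan_perp_diag[OF x])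
    also have "\<dots> = (\<Sum>\<alpha>\<in>pos_roots n. 2 * (x $$ \<alpha> * x $$ (snd \<alpha>, fst \<alpha>)))"
      by (subst sum_offdiag) (auto intro!: sum.cong)
    finally have "killing n x x = (\<Sum>\<alpha>\<in>pos_roots n. 4 * of_nat n * (x $$ \<alpha> * x $$ (snd \<alpha>, fst \<alpha>)))"
      using c tr by (simp add: killing_eq sum_distrib_left algebra_simps)
    also have "\<dots> = (\<Sum>\<alpha>\<in>pos_roots n. 2 * (x $$ \<alpha> * killing n x (unit_mat n (fst \<alpha>) (snd \<alpha>))))"
      by (rule sum.cong) (auto simp: killing_unit[OF c] pos_roots_def)
    finally have k: "killing n x x = \<dots>" .
    have "2 * clifford n x (clifford n x s) A = 2 * (killing n x x * s A)"
      using clifford_clifford[OF fin, of n x x s] unfolding k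
      by (simp add: sum_distrib_left algebra_simps)
    then show ?thesis by (simp add: spinor_scale_def)
  next
    case False
    have "clifford n x (clifford n x s) \<in> spinors n" using s clifford_stable by blast
    then show ?thesis using False s by (simp add: spinors_def spinor_scale_def)
  qed
qed

lemma clifford_unit:
  assumes "i < n" "j < n" "i \<noteq> j" 
  shows "clifford n (unit_mat n i j) s =
    (if i < j then wedge (i, j) s else spinor_scale (2 * of_nat (2 * n)) (contract (j, i) s))"
proof -
  have "clifford n (unit_mat n i j) s = (\<Sum>\<alpha>\<in>pos_roots n.
      if i < j then (if \<alpha> = (i, j) then wedge (i, j) s else 0)
      else (if \<alpha> = (j, i) then spinor_scale (2 * of_nat (2 * n)) (contract (j, i) s) else 0))"
    unfolding clifford_def
  proof (rule sum.cong)
    fix \<alpha> assume a: "\<alpha> \<in> pos_roots n"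
    obtain k l where kl: "\<alpha> = (k, l)" by (cases \<alpha>)
    then have lt: "k < l" "k < n" "l < n" using a by (auto simp: pos_roots_def)
    then show "spinor_scale (unit_mat n i j $$ \<alpha>) (wedge \<alpha> s)
        + spinor_scale (2 * killing n (unit_mat n i j) (unit_mat n (fst \<alpha>) (snd \<alpha>))) (contract \<alpha> s)
      = (if i < j then if \<alpha> = (i, j) then wedge (i, j) s else 0
         else if \<alpha> = (j, i) then spinor_scale (2 * of_nat (2 * n)) (contract (j, i) s) else 0)"
      using assms unfolding kl
      by (auto simp: killing_unit spinor_scale_def fun_eq_iff unit_mat_def[of n i j])
  qed simp
  then show ?thesis using assms finite_pos_roots[of n] by (auto simp: pos_roots_def)
qed

lemma ad_cartan_unit:
  assumes H: "H \<in> cartan n" and ij: "i < n" "j < n"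
  shows "ad H (unit_mat n i j) = (H $$ (i, i) - H $$ (j, j)) \<cdot>\<^sub>m unit_mat n i j"
proof (rule eq_matI)
  have c: "H \<in> carrier_mat n n" and d: "\<And>a b. a < n \<Longrightarrow> b < n \<Longrightarrow> a \<noteq> b \<Longrightarrow> H $$ (a, b) = 0"
    using H by (auto simp: cartan_def sl_def diagonal_mat_def)
  let ?E = "unit_mat n i j"
  fix k l
  assume "k < dim_row ((H $$ (i, i) - H $$ (j, j)) \<cdot>\<^sub>m ?E)" "l < dim_col ((H $$ (i, i) - H $$ (j, j)) \<cdot>\<^sub>m ?E)"
  then have kl: "k < n" "l < n" by (auto simp: unit_mat_def)
  have "(H * ?E) $$ (k, l) = (\<Sum>m = 0..<n. H $$ (k, m) * ?E $$ (m, l))"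
    using c kl by (simp add: scalar_prod_def unit_mat_def)
  also have "\<dots> = (\<Sum>m = 0..<n. if m = k then H $$ (k, k) * ?E $$ (k, l) else 0)"
    by (rule sum.cong) (use kl in \<open>auto simp: d\<close>)
  finally have 1: "(H * ?E) $$ (k, l) = H $$ (k, k) * ?E $$ (k, l)" using kl by simp
  have "(?E * H) $$ (k, l) = (\<Sum>m = 0..<n. ?E $$ (k, m) * H $$ (m, l))"
    using c kl by (simp add: scalar_prod_def unit_mat_def)
  also have "\<dots> = (\<Sum>m = 0..<n. if m = l then ?E $$ (k, l) * H $$ (l, l) else 0)"
    by (rule sum.cong) (use kl in \<open>auto simp: d\<close>)
  finally have 2: "(?E * H) $$ (k, l) = ?E $$ (k, l) * H $$ (l, l)" using kl by simp
  have "ad H ?E $$ (k, l) = (H * ?E) $$ (k, l) - (?E * H) $$ (k, l)"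
    unfolding ad_def by (rule index_minus_mat) (use c kl in \<open>auto simp: unit_mat_def\<close>)
  then show "ad H ?E $$ (k, l) = ((H $$ (i, i) - H $$ (j, j)) \<cdot>\<^sub>m ?E) $$ (k, l)"
    unfolding 1 2 using kl by (auto simp: unit_mat_def algebra_simps)
qed (use H in \<open>auto simp: ad_def unit_mat_def cartan_def sl_def\<close>)

lemma clifford_smult:
  assumes "y \<in> carrier_mat n n"
  shows "clifford n (c \<cdot>\<^sub>m y) s = spinor_scale c (clifford n y s)"
proof -
  have "(c \<cdot>\<^sub>m y) $$ \<alpha> = c * y $$ \<alpha>" "killing n (c \<cdot>\<^sub>m y) (unit_mat n (fst \<alpha>) (snd \<alpha>))
      = c * killing n y (unit_mat n (fst \<alpha>) (snd \<alpha>))" if "\<alpha> \<in> pos_roots n" for \<alpha>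
    using that assms by (auto simp: pos_roots_def killing_unit)
  then have "clifford n (c \<cdot>\<^sub>m y) s = (\<Sum>\<alpha>\<in>pos_roots n. spinor_scale c (spinor_scale (y $$ \<alpha>) (wedge \<alpha> s)
        + spinor_scale (2 * killing n y (unit_mat n (fst \<alpha>) (snd \<alpha>))) (contract \<alpha> s)))"
    unfolding clifford_def by (intro sum.cong refl) (auto simp: spinor_scale_def fun_eq_iff algebra_simps)
  then show ?thesis
    by (auto simp: clifford_def spinor_scale_def fun_eq_iff sum_fun_apply sum_distrib_left)
qed

theorem spin_act_eq:
  assumes H: "H \<in> cartan n" and s: "s \<in> spinors n" and A: "A \<subseteq> pos_roots n"
  shows "spin_act n H s A =
    ((\<Sum>\<alpha>\<in>A. root_val \<alpha> H) - (\<Sum>\<alpha>\<in>pos_roots n - A. root_val \<alpha> H)) / 2 * s A"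
proof -
  let ?R = "pos_roots n"
  define g where "g \<alpha> = (case \<alpha> of (i, j) \<Rightarrow> spinor_scale (1 / (4 * killing n (unit_mat n i j) (unit_mat n j i)))
          (clifford n (ad H (unit_mat n i j)) (clifford n (unit_mat n j i) s)) A)" for \<alpha>
  have fin: "finite A" using A finite_pos_roots finite_subset by blast
  have g: "g \<alpha> + g (snd \<alpha>, fst \<alpha>) = (if \<alpha> \<in> A then root_val \<alpha> H * s A / 2 else - root_val \<alpha> H * s A / 2)"
    if a: "\<alpha> \<in> ?R" for \<alpha>
  proof -
    obtain i j where ij: "\<alpha> = (i, j)" by (cases \<alpha>)
    with a have lt: "i < j" "i < n" "j < n" by (auto simp: pos_roots_def)
    have wc: "wedge (i, j) (contract (i, j) s) A = (if \<alpha> \<in> A then s A else 0)"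
      "contract (i, j) (wedge (i, j) s) A = (if \<alpha> \<in> A then 0 else s A)"
      using wedge_contract[OF fin, of "(i, j)" "(i, j)" s] ij by (auto simp: wedge_def contract_def split: if_splits)
    have n: "n \<noteq> 0" using lt by auto
    have kill: "killing n (unit_mat n i j) (unit_mat n j i) = 2 * of_nat n"
      "killing n (unit_mat n j i) (unit_mat n i j) = 2 * of_nat n"
      using lt killing_unit[of "unit_mat n i j" n j i] killing_unit[of "unit_mat n j i" n i j]
      by (simp_all add: unit_mat_def)
    show ?thesis
      using lt n unfolding g_def ij
      by (simp add: ad_cartan_unit[OF H] clifford_smult clifford_unit kill wedge_linear spinor_scale_def [of _ "_ :: spinor"] root_val_def)
         (auto simp: wc ij field_simps wedge_linear(2)[unfolded spinor_scale_def])
  qed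
  have "spin_act n H s A = (\<Sum>\<alpha>\<in>{(i, j). i < n \<and> j < n \<and> i \<noteq> j}. g \<alpha>)"
    unfolding spin_act_def spin_so_def g_def by (simp add: sum_fun_apply case_prod_unfold)
  also have "\<dots> = (\<Sum>\<alpha>\<in>?R. if \<alpha> \<in> A then root_val \<alpha> H * s A / 2 else - root_val \<alpha> H * s A / 2)"
    unfolding sum_offdiag by (rule sum.cong) (auto simp: g)
  also have "\<dots> = (\<Sum>\<alpha>\<in>A. root_val \<alpha> H * s A / 2) + (\<Sum>\<alpha>\<in>?R - A. - root_val \<alpha> H * s A / 2)"
    using A finite_pos_roots[of n] by (simp add: sum.If_cases Int_absorb1 Diff_eq Collect_neg_eq)
  finally show ?thesis
    by (simp add: sum_distrib_right sum_subtractf sum_negf sum_divide_distrib diff_divide_distrib left_diff_distrib)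
qed

lemma vector_space_spinor: "vector_space spinor_scale"
  by standard (auto simp: spinor_scale_def fun_eq_iff algebra_simps)

definition spin_weight :: "nat \<Rightarrow> (nat \<times> nat) set \<Rightarrow> complex mat \<Rightarrow> complex" where
  "spin_weight n A H =
     ((\<Sum>\<alpha>\<in>pos_roots n - A. root_val \<alpha> H) - (\<Sum>\<alpha>\<in>A. root_val \<alpha> H)) / 2"

theorem spin_mult_eq_card:
  "spin_mult n \<mu> = card {A. A \<subseteq> pos_roots n \<and> (\<forall>H\<in>cartan n. spin_weight n A H = \<mu> H)}"
proof -
  interpret V: vector_space spinor_scale by (rule vector_space_spinor)
  let ?R = "pos_roots n"
  define W where "W = {A. A \<subseteq> ?R \<and> (\<forall>H\<in>cartan n. spin_weight n (?R - A) H = \<mu> H)}"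
  define e where "e A = (\<lambda>B. if B = A then 1 else 0 :: complex)" for A :: "(nat \<times> nat) set"
  have finW: "finite W" unfolding W_def
    by (rule finite_subset[of _ "Pow ?R"]) (auto simp: finite_pos_roots)
  have inj: "inj_on e W" by (rule inj_onI) (auto simp: e_def fun_eq_iff split: if_splits)
  have act: "spin_act n H s A = spin_weight n (?R - A) H * s A"
    if "H \<in> cartan n" "s \<in> spinors n" "A \<subseteq> ?R" for H s A
    using that by (simp add: spin_act_eq spin_weight_def double_diff)
  have out: "spin_act n H s A = 0" if "s \<in> spinors n" "\<not> A \<subseteq> ?R" for H s A
    using that clifford_stable by (simp add: spin_act_def spin_so_def sum_fun_apply case_prod_unfold spinors_def spinor_scale_def)
  have ws: "weight_space n \<mu> = {s. \<forall>A. A \<notin> W \<longrightarrow> s A = 0}"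
  proof (rule subset_antisym; rule subsetI)
    fix s assume "s \<in> weight_space n \<mu>"
    then have s: "s \<in> spinors n" and eq: "\<And>H. H \<in> cartan n \<Longrightarrow> spin_act n H s = spinor_scale (\<mu> H) s"
      by (auto simp: weight_space_def)
    have "s A = 0" if A: "A \<notin> W" for A
    proof (cases "A \<subseteq> ?R")
      case True
      then obtain H where H: "H \<in> cartan n" "spin_weight n (?R - A) H \<noteq> \<mu> H"
        using A by (auto simp: W_def)
      have "spin_weight n (?R - A) H * s A = \<mu> H * s A"
        using act[OF H(1) s True] fun_cong[OF eq[OF H(1)], of A] by (simp only: spinor_scale_def)
      then show ?thesis using H(2) by simp
    qed (use s in \<open>auto simp: spinors_def\<close>)
    then show "s \<in> {s. \<forall>A. A \<notin> W \<longrightarrow> s A = 0}" by simp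
  next
    fix s :: spinor assume "s \<in> {s. \<forall>A. A \<notin> W \<longrightarrow> s A = 0}"
    then have z: "\<And>A. A \<notin> W \<Longrightarrow> s A = 0" by simp
    then have s: "s \<in> spinors n" by (auto simp: spinors_def W_def)
    have "spin_act n H s A = \<mu> H * s A" if H: "H \<in> cartan n" for H A
    proof (cases "A \<subseteq> ?R")
      case True
      show ?thesis
      proof (cases "A \<in> W")
        case True
        then show ?thesis using act[OF H s] H by (auto simp: W_def)
      qed (use True act[OF H s] z in auto)
    next
      case False
      then have "A \<notin> W" by (auto simp: W_def)
      then show ?thesis using out[OF s False] z by simp
    qed
    then show "s \<in> weight_space n \<mu>"
      using s by (auto simp: weight_space_def spinor_scale_def fun_eq_iff)
  qed
  have comb: "(\<Sum>v\<in>e ` W. spinor_scale (c v) v) = (\<lambda>A. if A \<in> W then c (e A) else 0)" for c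
  proof
    fix A
    have "(\<Sum>v\<in>e ` W. spinor_scale (c v) v) A = (\<Sum>B\<in>W. if A = B then c (e A) else 0)"
      unfolding sum.reindex[OF inj] sum_fun_apply
      by (rule sum.cong) (auto simp: spinor_scale_def e_def)
    then show "(\<Sum>v\<in>e ` W. spinor_scale (c v) v) A = (if A \<in> W then c (e A) else 0)"
      using finW by simp
  qed
  have "V.dim (weight_space n \<mu>) = card (e ` W)"
  proof (rule V.dim_unique)
    show "e ` W \<subseteq> weight_space n \<mu>" unfolding ws by (auto simp: e_def)
    show "weight_space n \<mu> \<subseteq> V.span (e ` W)"
    proof
      fix s assume "s \<in> weight_space n \<mu>"
      then have z: "\<And>A. A \<notin> W \<Longrightarrow> s A = 0" unfolding ws by simp
      have "s = (\<Sum>A\<in>W. spinor_scale (s A) (e A))"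
      proof
        fix A
        have "(\<Sum>B\<in>W. spinor_scale (s B) (e B)) A = (\<Sum>B\<in>W. if A = B then s A else 0)"
          unfolding sum_fun_apply by (rule sum.cong) (auto simp: spinor_scale_def e_def)
        then show "s A = (\<Sum>B\<in>W. spinor_scale (s B) (e B)) A"
          using finW z by simp
      qed
      also have "\<dots> \<in> V.span (e ` W)"
        by (intro V.span_sum V.span_scale V.span_base) auto
      finally show "s \<in> V.span (e ` W)" .
    qed
    show "V.independent (e ` W)"
    proof
      assume "V.dependent (e ` W)"
      then obtain c A where A: "A \<in> W" "c (e A) \<noteq> 0"
        and 0: "(\<Sum>v\<in>e ` W. spinor_scale (c v) v) = 0"
        unfolding V.dependent_finite[OF finite_imageI[OF finW]] by blast
      have "(if A \<in> W then c (e A) else 0) = 0"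
        using fun_cong[OF 0[unfolded comb], of A] by (simp only: zero_fun_apply)
      then show False using A by simp
    qed
  qed simp
  also have "\<dots> = card W" by (rule card_image[OF inj])
  also have "\<dots> = card {A. A \<subseteq> ?R \<and> (\<forall>H\<in>cartan n. spin_weight n A H = \<mu> H)}"
    by (rule bij_betw_same_card[of "\<lambda>A. ?R - A"],
        rule bij_betw_byWitness[where f' = "\<lambda>A. ?R - A"])
      (simp_all add: W_def double_diff image_subset_iff)
  finally show ?thesis unfolding spin_mult_def .
qed

lemma finite_boxes: "finite (boxes n l)"
  by (rule finite_subset[of _ "SIGMA r:{1..n}. {1..l r}"]) (auto simp: boxes_def)

lemma finite_spin_tableaux: "finite (spin_tableaux n l)"
proof (rule finite_subset)
  show "spin_tableaux n l \<subseteq>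
      {t. (\<forall>b. (b \<in> boxes n l \<longrightarrow> t b \<in> {1..n - 1}) \<and> (b \<notin> boxes n l \<longrightarrow> t b = 0))}"
    unfolding spin_tableaux_def by blast
  show "finite {t. (\<forall>b. (b \<in> boxes n l \<longrightarrow> t b \<in> {1..n - 1}) \<and> (b \<notin> boxes n l \<longrightarrow> t b = 0))}"
    by (rule finite_set_of_finite_funs) (auto simp: finite_boxes)
qed

end

theory Submission
  imports Defs "HOL-Combinatorics.Permutations"
begin

text \<open>
  Reading \<open>(i, j) \<notin> A\<close> as a win of \<open>i\<close> over \<open>j\<close>, a set \<open>A\<close> of positive roots is a tournament, and its
  weight records the scores of the players; so the multiplicity is the number of tournaments with
  scores \<open>l\<close>.  Removing the last player lowers by one the scores in some set \<open>E\<close> of the other players.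
  Since the number of tournaments is symmetric in the scores, sets \<open>E\<close> meeting each level of \<open>l\<close> in
  the same number of elements contribute equally; they are counted by a product of binomial
  coefficients, and exactly one of them makes the lowered sequence a partition.  Removing the
  boxes with the largest entry from spin tableaux gives the same recursion.
\<close>

section \<open>Tournaments with prescribed scores\<close>

text \<open>A pair \<open>(i, j)\<close> in \<open>W\<close> means that \<open>i\<close> beats
  \<open>j\<close>. The case \<open>i = j\<close> of the equivalence forbids games of a player
  against itself.\<close>

definition tournaments :: "'a set \<Rightarrow> ('a \<times> 'a) set set" where
  "tournaments V = {W. W \<subseteq> V \<times> V \<and> (\<forall>i\<in>V. \<forall>j\<in>V. (i, j) \<in> W \<longleftrightarrow> i \<noteq> j \<and> (j, i) \<notin> W)}"

text \<open>The score of \<open>v\<close> is the number of players that it beats, i.e. the number of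
  successors of \<open>v\<close> in \<open>W\<close>.\<close>

definition num_tournaments :: "'a set \<Rightarrow> ('a \<Rightarrow> nat) \<Rightarrow> nat" where
  "num_tournaments V f = card {W \<in> tournaments V. \<forall>v\<in>V. card (W `` {v}) = f v}"

lemma finite_tournaments: "finite V \<Longrightarrow> finite (tournaments V)"
  by (rule finite_subset[of _ "Pow (V \<times> V)"]) (auto simp: tournaments_def)

lemma tournaments_subset: "W \<in> tournaments V \<Longrightarrow> W \<subseteq> V \<times> V"
  by (simp add: tournaments_def)

lemma tournaments_iff:
  "W \<in> tournaments V \<Longrightarrow> i \<in> V \<Longrightarrow> j \<in> V \<Longrightarrow> (i, j) \<in> W \<longleftrightarrow> i \<noteq> j \<and> (j, i) \<notin> W"
  unfolding tournaments_def by blast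

lemma num_tournaments_cong:
  "(\<And>v. v \<in> V \<Longrightarrow> f v = g v) \<Longrightarrow> num_tournaments V f = num_tournaments V g"
  by (simp add: num_tournaments_def)

text \<open>Relabelling the players along an injection preserves results and scores. This serves for
  the symmetry under permutations and for the passage from players numbered from 0 to players
  numbered from 1.\<close>

lemma num_tournaments_image:
  assumes inj: "inj_on g V"
  shows "num_tournaments (g ` V) f = num_tournaments V (f \<circ> g)"
proof -
  let ?G = "(`) (map_prod g g)"
  let ?S = "{W \<in> tournaments V. \<forall>v\<in>V. card (W `` {v}) = (f \<circ> g) v}"
  let ?T = "{W \<in> tournaments (g ` V). \<forall>v\<in>g ` V. card (W `` {v}) = f v}"
  have inj2: "inj_on (map_prod g g) (V \<times> V)"
    using inj by (auto simp: inj_on_def)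
  have mem: "(g i, g j) \<in> ?G W \<longleftrightarrow> (i, j) \<in> W" if "W \<subseteq> V \<times> V" "i \<in> V" "j \<in> V" for W i j
    using inj_on_image_mem_iff[OF inj2 _ that(1), of "(i, j)"] that by simp
  have sec: "card (?G W `` {g v}) = card (W `` {v})" if W: "W \<subseteq> V \<times> V" and v: "v \<in> V" for W v
  proof -
    have "?G W `` {g v} = g ` (W `` {v})"
    proof (intro subset_antisym subsetI)
      fix y assume "y \<in> ?G W `` {g v}"
      then obtain i j where ij: "(i, j) \<in> W" "g v = g i" "y = g j" by auto
      then have "i = v" using inj_onD[OF inj, of v i] W v by blast
      then show "y \<in> g ` (W `` {v})" using ij by blast
    next
      fix y assume "y \<in> g ` (W `` {v})"
      then show "y \<in> ?G W `` {g v}" by force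
    qed
    moreover have "inj_on g (W `` {v})" using W by (intro inj_on_subset[OF inj]) auto
    ultimately show ?thesis by (simp add: card_image)
  qed
  have "bij_betw ?G ?S ?T"
  proof (rule bij_betw_imageI)
    show "inj_on ?G ?S"
      by (rule inj_on_subset[OF inj_on_image_Pow[OF inj2]]) (auto simp: tournaments_def)
    have 1: "?G W \<in> ?T \<longleftrightarrow> W \<in> ?S" if W: "W \<subseteq> V \<times> V" for W
    proof -
      have "?G W \<subseteq> g ` V \<times> g ` V" using W by auto
      then show ?thesis
        using W inj by (simp add: tournaments_def mem sec inj_on_eq_iff)
    qed
    have 2: "\<exists>W. W \<subseteq> V \<times> V \<and> U = ?G W" if "U \<in> ?T" for U
    proof -
      have "U \<subseteq> map_prod g g ` (V \<times> V)"
        using that by (auto simp: tournaments_def map_prod_surj_on)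
      then show ?thesis by (simp add: subset_image_iff)
    qed
    have 3: "W \<subseteq> V \<times> V" if "W \<in> ?S" for W
      using that tournaments_subset by blast
    show "?G ` ?S = ?T"
    proof (intro subset_antisym image_subsetI subsetI)
      show "?G W \<in> ?T" if "W \<in> ?S" for W
        using that 1[OF 3[OF that]] by simp
      fix U assume U: "U \<in> ?T"
      then obtain W where "W \<subseteq> V \<times> V" "U = ?G W" using 2[OF U] by blast
      with 1[of W] U show "U \<in> ?G ` ?S" by blast
    qed
  qed
  then show ?thesis
    unfolding num_tournaments_def by (simp add: bij_betw_same_card)
qed

text \<open>A tournament on \<open>insert v V\<close> amounts to the set \<open>E\<close> of players
  beating \<open>v\<close> together with a tournament on \<open>V\<close>. Members of
  \<open>E\<close> owe one win to \<open>v\<close>, and \<open>v\<close> beats exactly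
  \<open>V - E\<close>. The condition \<open>f i > 0\<close> keeps the truncated subtraction
  honest.\<close>

lemma num_tournaments_insert:
  assumes fin: "finite V" and v: "v \<notin> V"
  shows "num_tournaments (insert v V) f =
    (\<Sum>E | E \<subseteq> V \<and> (\<forall>i\<in>E. f i > 0) \<and> card E + f v = card V.
       num_tournaments V (\<lambda>i. f i - (if i \<in> E then 1 else 0)))"
proof -
  let ?V = "insert v V"
  let ?S = "{W \<in> tournaments ?V. \<forall>u\<in>?V. card (W `` {u}) = f u}"
  let ?\<E> = "{E. E \<subseteq> V \<and> (\<forall>i\<in>E. f i > 0) \<and> card E + f v = card V}"
  let ?T = "\<lambda>E. {W \<in> tournaments V. \<forall>u\<in>V. card (W `` {u}) = f u - (if u \<in> E then 1 else 0)}"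
  \<comment> \<open>The two maps are mutually inverse: \<open>?r\<close> forgets the games of
    \<open>v\<close> but records who won them, \<open>?e\<close> puts them back.\<close>
  let ?r = "\<lambda>W. ({i \<in> V. (i, v) \<in> W}, W \<inter> V \<times> V)"
  let ?e = "\<lambda>(E, W). W \<union> E \<times> {v} \<union> {v} \<times> (V - E)"
  have sec: "W `` {u} = (W \<inter> V \<times> V) `` {u} \<union> (if (u, v) \<in> W then {v} else {})"
    if "W \<in> tournaments ?V" "u \<in> V" for W u
    using tournaments_subset[OF that(1)] that(2) v by auto
  have vv: "(v, v) \<notin> W" "\<And>i. i \<in> V \<Longrightarrow> (v, i) \<in> W \<longleftrightarrow> (i, v) \<notin> W"
    if "W \<in> tournaments ?V" for W
    using tournaments_iff[OF that] v by blast+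
  have secv: "W `` {v} = V - {i \<in> V. (i, v) \<in> W}" if "W \<in> tournaments ?V" for W
    using tournaments_subset[OF that] vv[OF that] by blast
  have finsec: "finite ((W \<inter> V \<times> V) `` {u})" "v \<notin> (W \<inter> V \<times> V) `` {u}" for W u
    using fin v by (auto intro!: finite_Image finite_subset[of "W \<inter> V \<times> V" "V \<times> V"])
  have csec: "card (W `` {u}) = card ((W \<inter> V \<times> V) `` {u}) + (if (u, v) \<in> W then 1 else 0)"
    if "W \<in> tournaments ?V" "u \<in> V" for W u
    using finsec by (auto simp: sec[OF that])
  have csecv: "card (W `` {v}) + card {i \<in> V. (i, v) \<in> W} = card V" if "W \<in> tournaments ?V" for W
    using fin card_Diff_subset[of "{i \<in> V. (i, v) \<in> W}" V] card_mono[of V "{i \<in> V. (i, v) \<in> W}"]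
    by (auto simp: secv[OF that])
  have "bij_betw ?r ?S (SIGMA E:?\<E>. ?T E)"
  proof (rule bij_betw_byWitness[where f' = ?e])
    show "\<forall>W\<in>?S. ?e (?r W) = W"
    proof
      fix W assume "W \<in> ?S"
      then have t: "W \<in> tournaments ?V" by simp
      show "?e (?r W) = W"
        using tournaments_subset[OF t] vv[OF t] by auto
    qed
    show "\<forall>p\<in>SIGMA E:?\<E>. ?T E. ?r (?e p) = p"
      using v by (auto dest: tournaments_subset)
    show "?r ` ?S \<subseteq> (SIGMA E:?\<E>. ?T E)"
    proof (rule image_subsetI)
      fix W assume W: "W \<in> ?S"
      then have t: "W \<in> tournaments ?V" and s: "\<And>u. u \<in> ?V \<Longrightarrow> card (W `` {u}) = f u" by auto
      have "W \<inter> V \<times> V \<in> tournaments V"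
        unfolding tournaments_def using tournaments_iff[OF t] by blast
      moreover have "0 < f u" if "u \<in> V" "(u, v) \<in> W" for u
        using csec[OF t that(1)] s[of u] that by simp
      moreover have "card ((W \<inter> V \<times> V) `` {u}) = f u - (if (u, v) \<in> W then 1 else 0)" if "u \<in> V" for u
        using csec[OF t that] s[of u] that by simp
      moreover have "card {i \<in> V. (i, v) \<in> W} + f v = card V"
        using csecv[OF t] s[of v] by simp
      ultimately show "?r W \<in> (SIGMA E:?\<E>. ?T E)" by auto
    qed
    show "?e ` (SIGMA E:?\<E>. ?T E) \<subseteq> ?S"
    proof (rule image_subsetI)
      fix p assume p: "p \<in> (SIGMA E:?\<E>. ?T E)"
      then obtain E W where EW: "p = (E, W)" "E \<in> ?\<E>" "W \<in> ?T E" by blast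
      then have E: "E \<subseteq> V" "\<And>i. i \<in> E \<Longrightarrow> f i > 0" "card E + f v = card V"
        and W: "W \<in> tournaments V" "\<And>u. u \<in> V \<Longrightarrow> card (W `` {u}) = f u - (if u \<in> E then 1 else 0)"
        by auto
      have t: "?e p \<in> tournaments ?V"
        unfolding tournaments_def mem_Collect_eq
      proof (intro conjI ballI)
        show "?e p \<subseteq> ?V \<times> ?V"
          using tournaments_subset[OF W(1)] E(1) unfolding EW by auto
        fix i j assume "i \<in> ?V" "j \<in> ?V"
        then show "(i, j) \<in> ?e p \<longleftrightarrow> i \<noteq> j \<and> (j, i) \<notin> ?e p"
          using tournaments_subset[OF W(1)] tournaments_iff[OF W(1), of i j] E(1) v unfolding EW by auto
      qed
      have r: "{i \<in> V. (i, v) \<in> ?e p} = E" "?e p \<inter> V \<times> V = W"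
        using tournaments_subset[OF W(1)] E(1) v unfolding EW by auto
      have "card (?e p `` {u}) = f u" if "u \<in> V" for u
      proof -
        have "(u, v) \<in> ?e p \<longleftrightarrow> u \<in> E" using r(1) that by blast
        then show ?thesis using csec[OF t that] W(2)[OF that] E(2)[of u] unfolding r by auto
      qed
      moreover have "card (?e p `` {v}) = f v" using csecv[OF t] E(3) unfolding r by simp
      ultimately show "?e p \<in> ?S" using t by auto
    qed
  qed
  then have "num_tournaments ?V f = card (SIGMA E:?\<E>. ?T E)"
    unfolding num_tournaments_def by (simp only: bij_betw_same_card)
  also have "\<dots> = (\<Sum>E\<in>?\<E>. card (?T E))"
    using fin by (intro card_SigmaI) (auto simp: finite_tournaments)
  finally show ?thesis by (simp add: num_tournaments_def)
qed

text \<open>The number of tournaments is a symmetric function of the scores: \<open>p\<close> merely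
  renames the players.\<close>

lemma num_tournaments_permutes:
  assumes p: "p permutes V"
    and fg: "\<And>v. v \<in> V \<Longrightarrow> f v = g (p v)"
  shows "num_tournaments V f = num_tournaments V g"
  using num_tournaments_image[of p V g] p fg num_tournaments_cong[of V f "g \<circ> p"]
  by (simp add: permutes_image permutes_inj_on)

section \<open>Lowering the scores on a set of players\<close>

text \<open>The set \<open>U\<close> consists of the \<open>k\<close> largest elements of
  \<open>B\<close>; it grows by adding the maximum of its complement.\<close>

lemma ex1_upward_closed:
  fixes B :: "'a :: linorder set"
  assumes fin: "finite B" and k: "k \<le> card B"
  shows "\<exists>!U. U \<subseteq> B \<and> card U = k \<and> (\<forall>i\<in>U. \<forall>j\<in>B. i < j \<longrightarrow> j \<in> U)"
proof (rule ex_ex1I)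
  show "\<exists>U. U \<subseteq> B \<and> card U = k \<and> (\<forall>i\<in>U. \<forall>j\<in>B. i < j \<longrightarrow> j \<in> U)"
    using k
  proof (induction k)
    case 0
    then show ?case by (intro exI[of _ "{}"]) auto
  next
    case (Suc k)
    then obtain U where U: "U \<subseteq> B" "card U = k" "\<forall>i\<in>U. \<forall>j\<in>B. i < j \<longrightarrow> j \<in> U" by auto
    have ne: "B - U \<noteq> {}" using U Suc.prems fin by (metis Diff_eq_empty_iff card_mono finite_subset not_less_eq_eq)
    let ?m = "Max (B - U)"
    have m: "?m \<in> B - U" and max: "\<And>j. j \<in> B - U \<Longrightarrow> j \<le> ?m"
      using Max_in[OF _ ne] fin by auto
    show ?case
    proof (intro exI[of _ "insert ?m U"] conjI ballI impI)
      show "card (insert ?m U) = Suc k"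
        using m U fin by (simp add: finite_subset)
      show "j \<in> insert ?m U" if "i \<in> insert ?m U" "j \<in> B" "i < j" for i j
        using that U(3) max[of j] by auto
    qed (use m U in auto)
  qed
next
  fix U U'
  assume U: "U \<subseteq> B \<and> card U = k \<and> (\<forall>i\<in>U. \<forall>j\<in>B. i < j \<longrightarrow> j \<in> U)"
    and U': "U' \<subseteq> B \<and> card U' = k \<and> (\<forall>i\<in>U'. \<forall>j\<in>B. i < j \<longrightarrow> j \<in> U')"
  \<comment> \<open>Given elements of the two differences, the larger one would lie in both sets by
    upward closure. Sets of equal size that are comparable coincide.\<close>
  have "U \<subseteq> U' \<or> U' \<subseteq> U"
  proof (rule ccontr)
    assume "\<not> ?thesis"
    then obtain a b where "a \<in> U" "a \<notin> U'" "b \<in> U'" "b \<notin> U" by blast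
    then show False using U U' by (cases a b rule: linorder_cases) blast+
  qed
  moreover have "finite U" "finite U'" using U U' fin finite_subset by blast+
  ultimately show "U = U'" using U U' card_subset_eq by metis
qed

text \<open>A larger index is a lower row of the diagram: among rows of equal length,
  \<open>E\<close> contains the lowest ones.\<close>

definition bottom_closed :: "'a set \<Rightarrow> ('a \<Rightarrow> 'b) \<Rightarrow> 'a :: linorder set \<Rightarrow> bool" where
  "bottom_closed B h E \<longleftrightarrow> (\<forall>i\<in>E. \<forall>j\<in>B. i < j \<and> h i = h j \<longrightarrow> j \<in> E)"

text \<open>For subsets of a finite set this says that a permutation preserving \<open>h\<close>
  carries one to the other; see \<open>same_levels_permutes\<close>.\<close>

definition same_levels :: "('a \<Rightarrow> 'b) \<Rightarrow> 'a set \<Rightarrow> 'a set \<Rightarrow> bool" where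
  "same_levels h D E \<longleftrightarrow> (\<forall>c. card {i \<in> D. h i = c} = card {i \<in> E. h i = c})"

text \<open>Each class of subsets with the same level counts has one canonical representative: on
  every level, \<open>ex1_upward_closed\<close> selects the required number of largest elements, and
  \<open>D\<close> collects these selections.\<close>

lemma ex1_bottom_closed:
  fixes B :: "'a :: linorder set"
  assumes fin: "finite B" and E: "E \<subseteq> B"
  shows "\<exists>!D. D \<subseteq> B \<and> bottom_closed B h D \<and> same_levels h D E"
proof -
  let ?P = "\<lambda>c U. U \<subseteq> {i \<in> B. h i = c} \<and> card U = card {i \<in> E. h i = c}
    \<and> (\<forall>i\<in>U. \<forall>j\<in>{i \<in> B. h i = c}. i < j \<longrightarrow> j \<in> U)"
  have ex1: "\<exists>!U. ?P c U" for c
    by (rule ex1_upward_closed) (use fin E in \<open>auto intro!: card_mono\<close>)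
  define U where "U c = (THE U. ?P c U)" for c
  have U: "?P c (U c)" for c
    unfolding U_def by (rule theI'[OF ex1])
  have uniq: "U' = U c" if "?P c U'" for c U'
    unfolding U_def by (rule the1_equality[OF ex1 that, symmetric])
  show ?thesis
  proof (rule ex1I[of _ "{i \<in> B. i \<in> U (h i)}"])
    have "i \<in> {i \<in> {i \<in> B. i \<in> U (h i)}. h i = c} \<longleftrightarrow> i \<in> U c" for i c
      using U[of c] by auto
    then have "{i \<in> {i \<in> B. i \<in> U (h i)}. h i = c} = U c" for c by blast
    then have "same_levels h {i \<in> B. i \<in> U (h i)} E"
      unfolding same_levels_def using U by simp
    moreover have "bottom_closed B h {i \<in> B. i \<in> U (h i)}"
      unfolding bottom_closed_def
    proof (intro ballI impI)
      fix i j assume "i \<in> {i \<in> B. i \<in> U (h i)}" "j \<in> B" "i < j \<and> h i = h j"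
      then show "j \<in> {i \<in> B. i \<in> U (h i)}" using U[of "h j"] by auto
    qed
    ultimately show "{i \<in> B. i \<in> U (h i)} \<subseteq> B \<and> bottom_closed B h {i \<in> B. i \<in> U (h i)}
      \<and> same_levels h {i \<in> B. i \<in> U (h i)} E" by auto
  next
    fix D assume D: "D \<subseteq> B \<and> bottom_closed B h D \<and> same_levels h D E"
    have eq: "{i \<in> D. h i = c} = U c" for c
    proof (rule uniq, intro conjI)
      show "card {i \<in> D. h i = c} = card {i \<in> E. h i = c}" using D by (simp add: same_levels_def)
      show "\<forall>i\<in>{i \<in> D. h i = c}. \<forall>j\<in>{i \<in> B. h i = c}. i < j \<longrightarrow> j \<in> {i \<in> D. h i = c}"
        using D by (auto simp: bottom_closed_def)
    qed (use D in auto)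
    have "i \<in> D \<longleftrightarrow> i \<in> B \<and> i \<in> U (h i)" for i
      using D unfolding eq[symmetric] by auto
    then show "D = {i \<in> B. i \<in> U (h i)}" by auto
  qed
qed

text \<open>Each \<open>i\<close> is labelled by its level and by its membership in the subset.
  Equal level counts of \<open>D\<close> and \<open>E\<close> give equal counts of their complements
  in \<open>B\<close>, so the two labellings have the same multiset of labels and differ by a
  permutation.\<close>

lemma same_levels_permutes:
  assumes fin: "finite B" and "D \<subseteq> B" "E \<subseteq> B" and same: "same_levels h D E"
  obtains p where "p permutes B" "\<And>i. i \<in> B \<Longrightarrow> h i = h (p i)" "\<And>i. i \<in> B \<Longrightarrow> i \<in> E \<longleftrightarrow> p i \<in> D"
proof -
  have cnt: "count (image_mset (\<lambda>i. (h i, i \<in> X)) (mset_set B)) (c, b) =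
      (if b then card {i \<in> X. h i = c} else card {i \<in> B. h i = c} - card {i \<in> X. h i = c})"
    if X: "X \<subseteq> B" for X c b
  proof -
    have "count (image_mset (\<lambda>i. (h i, i \<in> X)) (mset_set B)) (c, b) = (\<Sum>i | i \<in> B \<and> h i = c \<and> (i \<in> X) = b. 1)"
      unfolding count_image_mset' by (rule sum.cong) (use fin in auto)
    also have "\<dots> = card {i \<in> B. h i = c \<and> (i \<in> X) = b}" by simp
    also have "{i \<in> B. h i = c \<and> (i \<in> X) = b}
      = (if b then {i \<in> X. h i = c} else {i \<in> B. h i = c} - {i \<in> X. h i = c})"
      using X by auto
    finally show ?thesis
      using X fin by (auto simp: card_Diff_subset finite_subset subset_iff)
  qed
  have "image_mset (\<lambda>i. (h i, i \<in> E)) (mset_set B) = image_mset (\<lambda>i. (h i, i \<in> D)) (mset_set B)"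
    using assms by (intro multiset_eqI) (auto simp: cnt same_levels_def)
  then obtain p where "p permutes B" "\<forall>i\<in>B. (h i, i \<in> E) = (h (p i), p i \<in> D)"
    using image_mset_eq_implies_permutes[OF fin] by blast
  then show thesis using that by auto
qed

text \<open>A subset is determined by its traces on the levels, and these can be chosen
  independently.\<close>

lemma card_level_subsets:
  assumes fin: "finite B" "finite C"
    and B: "\<And>i. i \<in> B \<Longrightarrow> h i \<in> C"
  shows "card {E. E \<subseteq> B \<and> (\<forall>c\<in>C. card {i \<in> E. h i = c} = k c)}
    = (\<Prod>c\<in>C. card {i \<in> B. h i = c} choose k c)"
proof -
  let ?S = "{E. E \<subseteq> B \<and> (\<forall>c\<in>C. card {i \<in> E. h i = c} = k c)}"
  let ?T = "\<lambda>c. {X. X \<subseteq> {i \<in> B. h i = c} \<and> card X = k c}"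
  have "bij_betw (\<lambda>E. \<lambda>c\<in>C. {i \<in> E. h i = c}) ?S (PiE C ?T)"
  proof (rule bij_betw_byWitness[where f' = "\<lambda>X. {i \<in> B. i \<in> X (h i)}"])
    have eq: "{i \<in> {i \<in> B. i \<in> X (h i)}. h i = c} = X c" if "X \<in> PiE C ?T" "c \<in> C" for X c
      using PiE_mem[OF that] that by blast
    show "\<forall>X\<in>PiE C ?T. (\<lambda>c\<in>C. {i \<in> {i \<in> B. i \<in> X (h i)}. h i = c}) = X"
    proof
      fix X assume X: "X \<in> PiE C ?T"
      show "(\<lambda>c\<in>C. {i \<in> {i \<in> B. i \<in> X (h i)}. h i = c}) = X"
        by (rule ext) (use eq[OF X] PiE_arb[OF X] in \<open>auto simp: restrict_def\<close>)
    qed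
    show "(\<lambda>X. {i \<in> B. i \<in> X (h i)}) ` PiE C ?T \<subseteq> ?S"
    proof (rule image_subsetI)
      fix X assume X: "X \<in> PiE C ?T"
      show "{i \<in> B. i \<in> X (h i)} \<in> ?S"
        using eq[OF X] PiE_mem[OF X] by auto
    qed
  qed (use B in auto)
  then have "card ?S = card (PiE C ?T)" by (rule bij_betw_same_card)
  also have "\<dots> = (\<Prod>c\<in>C. card {i \<in> B. h i = c} choose k c)"
    using fin by (simp add: card_PiE n_subsets)
  finally show ?thesis .
qed

section \<open>The recursion for the number of tournaments\<close>

text \<open>Lowers scores when the last player leaves, and shortens rows when boxes are removed. For
  \<open>E\<close> inside \<open>{1..n}\<close> the value at \<open>Suc n\<close> is kept, but
  \<open>boxes n\<close> and tournaments on \<open>{1..n}\<close> do not look at it.\<close>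

definition lower :: "('a \<Rightarrow> nat) \<Rightarrow> 'a set \<Rightarrow> 'a \<Rightarrow> nat" where
  "lower l E = (\<lambda>i. l i - (if i \<in> E then 1 else 0))"

text \<open>The possible sets of players beating player \<open>Suc n\<close>. On the tableau side
  these are rows that lose their last box; with the whole row \<open>Suc n\<close> this makes
  \<open>n\<close> boxes.\<close>

definition removable :: "nat \<Rightarrow> (nat \<Rightarrow> nat) \<Rightarrow> nat set set" where
  "removable n l = {E. E \<subseteq> {1..n} \<and> (\<forall>i\<in>E. l i > 0) \<and> card E + l (Suc n) = n}"

lemma finite_removable: "finite (removable n l)"
  by (rule finite_subset[of _ "Pow {1..n}"]) (auto simp: removable_def)

text \<open>The summands of \<open>num_tournaments_insert\<close> are grouped by level counts. By
  symmetry they are constant on a group, each group contains one bottom-closed set, and its size is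
  a product of binomial coefficients. The bound \<open>M\<close> makes the product over levels
  finite.\<close>

lemma num_tournaments_Suc:
  assumes M: "\<And>i. i \<in> {1..n} \<Longrightarrow> l i \<le> M"
  shows "num_tournaments {1..Suc n} l =
    (\<Sum>E | E \<in> removable n l \<and> bottom_closed {1..n} l E.
       (\<Prod>c=1..M. card {i \<in> {1..n}. l i = c} choose card {i \<in> E. l i = c})
       * num_tournaments {1..n} (lower l E))"
proof -
  let ?B = "{1..n}"
  let ?R = "removable n l"
  let ?C = "{E \<in> ?R. bottom_closed ?B l E}"
  define g where "g E = (THE D. D \<subseteq> ?B \<and> bottom_closed ?B l D \<and> same_levels l D E)" for E
  have g: "g E \<subseteq> ?B \<and> bottom_closed ?B l (g E) \<and> same_levels l (g E) E" if "E \<subseteq> ?B" for E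
    unfolding g_def by (rule theI', rule ex1_bottom_closed) (use that in auto)
  have g_eq: "g E = D" if "E \<subseteq> ?B" "D \<subseteq> ?B" "bottom_closed ?B l D" "same_levels l D E" for D E
    unfolding g_def by (rule the1_equality, rule ex1_bottom_closed) (use that in auto)
  have RB: "E \<subseteq> ?B" if "E \<in> ?R" for E using that by (simp add: removable_def)
  \<comment> \<open>A permutation that preserves \<open>l\<close> and carries \<open>E\<close> to
    \<open>D\<close> also carries \<open>lower l E\<close> to \<open>lower l D\<close>.\<close>
  have transfer: "E \<in> ?R \<and> num_tournaments ?B (lower l E) = num_tournaments ?B (lower l D)"
    if D: "D \<in> ?R" and E: "E \<subseteq> ?B" and same: "same_levels l D E" for D E
  proof -
    obtain p where p: "p permutes ?B" "\<And>i. i \<in> ?B \<Longrightarrow> l i = l (p i)" "\<And>i. i \<in> ?B \<Longrightarrow> i \<in> E \<longleftrightarrow> p i \<in> D"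
      using same_levels_permutes[OF _ RB[OF D] E same] by blast
    have "p ` E = D"
    proof
      show "D \<subseteq> p ` E"
      proof
        fix d assume d: "d \<in> D"
        then obtain e where "e \<in> ?B" "d = p e"
          using RB[OF D] permutes_image[OF p(1)] by blast
        then show "d \<in> p ` E" using p(3) d by blast
      qed
    qed (use p(3) E in auto)
    then have "card E = card D"
      using permutes_inj_on[OF p(1)] card_image by metis
    moreover have "l i > 0" if "i \<in> E" for i
      using p(2,3)[of i] that E D by (auto simp: removable_def subset_iff)
    ultimately have "E \<in> ?R" using D E by (auto simp: removable_def)
    moreover have "num_tournaments ?B (lower l E) = num_tournaments ?B (lower l D)"
      by (rule num_tournaments_permutes[OF p(1)]) (use p(2,3) in \<open>auto simp: lower_def\<close>)
    ultimately show ?thesis by simp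
  qed
  \<comment> \<open>The group represented by \<open>D\<close> consists of all subsets with the level
    counts of \<open>D\<close>; levels above \<open>M\<close> are empty, so finitely many conditions
    remain.\<close>
  have fibre: "{E \<in> ?R. g E = D} = {E. E \<subseteq> ?B \<and> (\<forall>c\<in>{..M}. card {i \<in> E. l i = c} = card {i \<in> D. l i = c})}"
    if "D \<in> ?C" for D
  proof -
    have D: "D \<in> ?R" "D \<subseteq> ?B" "bottom_closed ?B l D" using that RB by auto
    have "same_levels l D E \<longleftrightarrow> (\<forall>c\<in>{..M}. card {i \<in> E. l i = c} = card {i \<in> D. l i = c})"
      if E: "E \<subseteq> ?B" for E
    proof -
      have "{i \<in> X. l i = c} = {}" if "X \<subseteq> ?B" "\<not> c \<le> M" for X c
        using that M by auto
      then show ?thesis unfolding same_levels_def using E D(2) by (metis atMost_iff)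
    qed
    moreover have "E \<in> ?R \<and> g E = D \<longleftrightarrow> E \<subseteq> ?B \<and> same_levels l D E" for E
      using g[of E] g_eq[of E D] D transfer[of D E] RB[of E] by blast
    ultimately show ?thesis by (simp cong: conj_cong)
  qed
  have "num_tournaments {1..Suc n} l = (\<Sum>E\<in>?R. num_tournaments ?B (lower l E))"
    using num_tournaments_insert[of ?B "Suc n" l]
    by (simp add: atLeastAtMostSuc_conv removable_def lower_def)
  also have "\<dots> = (\<Sum>D\<in>?C. \<Sum>E | E \<in> ?R \<and> g E = D. num_tournaments ?B (lower l E))"
  proof (rule sum.group[symmetric])
    show "g ` ?R \<subseteq> ?C"
    proof (rule image_subsetI)
      fix E assume E: "E \<in> ?R"
      have "same_levels l E (g E)" using g[OF RB[OF E]] by (simp add: same_levels_def)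
      then show "g E \<in> ?C" using g[OF RB[OF E]] transfer[OF E] by auto
    qed
  qed (simp_all add: finite_removable)
  also have "\<dots> = (\<Sum>D\<in>?C. (\<Prod>c=1..M. card {i \<in> ?B. l i = c} choose card {i \<in> D. l i = c})
       * num_tournaments ?B (lower l D))"
  proof (rule sum.cong[OF refl])
    fix D assume D: "D \<in> ?C"
    have "(\<Sum>E | E \<in> ?R \<and> g E = D. num_tournaments ?B (lower l E))
      = (\<Sum>E | E \<in> ?R \<and> g E = D. num_tournaments ?B (lower l D))"
    proof (rule sum.cong[OF refl])
      fix E assume "E \<in> {E \<in> ?R. g E = D}"
      then have "E \<subseteq> ?B" "same_levels l D E" using g[of E] RB by auto
      then show "num_tournaments ?B (lower l E) = num_tournaments ?B (lower l D)"
        using transfer D by blast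
    qed
    also have "\<dots> = card {E \<in> ?R. g E = D} * num_tournaments ?B (lower l D)" by simp
    also have "card {E \<in> ?R. g E = D}
      = (\<Prod>c\<in>{..M}. card {i \<in> ?B. l i = c} choose card {i \<in> D. l i = c})"
      unfolding fibre[OF D] by (rule card_level_subsets) (use M in auto)
    \<comment> \<open>Level 0 gives the factor 1, because a removable set contains no
      \<open>i\<close> with \<open>l i = 0\<close>. The remaining levels match the columns of the
      diagram.\<close>
    also have "\<dots> = (\<Prod>c=1..M. card {i \<in> ?B. l i = c} choose card {i \<in> D. l i = c})"
    proof (rule prod.mono_neutral_right)
      have "{i \<in> D. l i = 0} = {}" using D by (auto simp: removable_def)
      then have 0: "card {i \<in> D. l i = 0} = 0" by (simp only: card.empty)
      show "\<forall>c\<in>{..M} - {1..M}. (card {i \<in> ?B. l i = c} choose card {i \<in> D. l i = c}) = 1"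
      proof
        fix c assume "c \<in> {..M} - {1..M}"
        then have "c = 0" by auto
        then show "(card {i \<in> ?B. l i = c} choose card {i \<in> D. l i = c}) = 1"
          by (simp only: 0 binomial_n_0)
      qed
    qed auto
    finally show "(\<Sum>E | E \<in> ?R \<and> g E = D. num_tournaments ?B (lower l E))
      = (\<Prod>c=1..M. card {i \<in> ?B. l i = c} choose card {i \<in> D. l i = c}) * num_tournaments ?B (lower l D)" .
  qed
  finally show ?thesis .
qed

section \<open>Removing the largest entry from spin tableaux\<close>

text \<open>If \<open>i\<close> does not occur in column \<open>j\<close>, then \<open>tab_b\<close>
  is 0 and the binomial coefficient is 1. So the product extends to a full rectangle, from which the
  factors of the largest entry can be split off.\<close>

lemma tab_N_eq:
  assumes t: "t \<in> spin_tableaux n l" and M: "\<And>i. i \<in> {1..n} \<Longrightarrow> l i \<le> M"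
  shows "tab_N n l t = (\<Prod>i=1..n - 1. \<Prod>j=1..M. tab_a n l t i j choose tab_b n l t i j)"
proof -
  have "(\<Prod>i=1..n - 1. \<Prod>j=1..M. tab_a n l t i j choose tab_b n l t i j)
    = (\<Prod>(i, j)\<in>{1..n - 1} \<times> {1..M}. tab_a n l t i j choose tab_b n l t i j)"
    by (simp add: prod.cartesian_product)
  also have "\<dots> = tab_N n l t"
    unfolding tab_N_def
  proof (rule prod.mono_neutral_right)
    have box: "t b \<in> {1..n - 1}" if "b \<in> boxes n l" for b
      using t that unfolding spin_tableaux_def mem_Collect_eq by blast
    have "i \<in> {1..n - 1} \<and> j \<in> {1..M}" if "(r, j) \<in> boxes n l" "t (r, j) = i" for r i j
      using box[OF that(1)] that M[of r] by (simp add: boxes_def)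
    then show "{(i, j). \<exists>r. (r, j) \<in> boxes n l \<and> t (r, j) = i} \<subseteq> {1..n - 1} \<times> {1..M}"
      by blast
    show "\<forall>x\<in>{1..n - 1} \<times> {1..M} - {(i, j). \<exists>r. (r, j) \<in> boxes n l \<and> t (r, j) = i}.
      (case x of (i, j) \<Rightarrow> tab_a n l t i j choose tab_b n l t i j) = 1"
    proof
      fix x assume x: "x \<in> {1..n - 1} \<times> {1..M} - {(i, j). \<exists>r. (r, j) \<in> boxes n l \<and> t (r, j) = i}"
      obtain i j where ij: "x = (i, j)" by (cases x)
      then have "tab_b n l t i j = 0" using x by (simp add: tab_b_def)
      then show "(case x of (i, j) \<Rightarrow> tab_a n l t i j choose tab_b n l t i j) = 1" by (simp add: ij)
    qed
  qed simp
  finally show ?thesis by simp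
qed

text \<open>Meant for tableaux with \<open>Suc n\<close> rows and largest entry \<open>n\<close>.
  Row \<open>Suc n\<close> is left out: an entry \<open>i\<close> lies in the first
  \<open>i + 1\<close> rows, so that row contains only entries \<open>n\<close>.\<close>

definition last_rows :: "nat \<Rightarrow> (nat \<Rightarrow> nat) \<Rightarrow> (nat \<times> nat \<Rightarrow> nat) \<Rightarrow> nat set" where
  "last_rows n l t = {r \<in> {1..n}. l r > 0 \<and> t (r, l r) = n}"

definition drop_last :: "nat \<Rightarrow> (nat \<times> nat \<Rightarrow> nat) \<Rightarrow> nat \<times> nat \<Rightarrow> nat" where
  "drop_last n t = (\<lambda>b. if t b = n then 0 else t b)"

definition add_last :: "nat \<Rightarrow> (nat \<Rightarrow> nat) \<Rightarrow> nat set \<Rightarrow> (nat \<times> nat \<Rightarrow> nat) \<Rightarrow> nat \<times> nat \<Rightarrow> nat" where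
  "add_last n l E t = (\<lambda>b. if b \<in> boxes n (lower l E) then t b else if b \<in> boxes (Suc n) l then n else 0)"

lemma boxes_lower:
  assumes "E \<subseteq> {1..n}" "\<forall>i\<in>E. l i > 0"
  shows "boxes (Suc n) l = boxes n (lower l E) \<union> (\<lambda>r. (r, l r)) ` E \<union> {Suc n} \<times> {1..l (Suc n)}"
    and "boxes n (lower l E) \<inter> (\<lambda>r. (r, l r)) ` E = {}"
    and "boxes n (lower l E) \<inter> {Suc n} \<times> {1..l (Suc n)} = {}"
proof -
  have "(r, c) \<in> boxes (Suc n) l \<longleftrightarrow>
    (r, c) \<in> boxes n (lower l E) \<union> (\<lambda>r. (r, l r)) ` E \<union> {Suc n} \<times> {1..l (Suc n)}" for r c
    using assms by (auto simp: boxes_def lower_def subset_iff le_Suc_eq image_iff Suc_le_eq)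
  then show "boxes (Suc n) l = boxes n (lower l E) \<union> (\<lambda>r. (r, l r)) ` E \<union> {Suc n} \<times> {1..l (Suc n)}"
    by auto
  show "boxes n (lower l E) \<inter> (\<lambda>r. (r, l r)) ` E = {}"
    using assms(2) by (force simp: boxes_def lower_def)
  show "boxes n (lower l E) \<inter> {Suc n} \<times> {1..l (Suc n)} = {}"
    by (auto simp: boxes_def)
qed

lemma card_boxes_last:
  assumes "E \<subseteq> {1..n}" "\<forall>i\<in>E. l i > 0"
  shows "card (boxes (Suc n) l - boxes n (lower l E)) = card E + l (Suc n)"
proof -
  have "boxes (Suc n) l - boxes n (lower l E) = (\<lambda>r. (r, l r)) ` E \<union> {Suc n} \<times> {1..l (Suc n)}"
    using boxes_lower[OF assms] by blast
  moreover have "card \<dots> = card ((\<lambda>r. (r, l r)) ` E) + card ({Suc n} \<times> {1..l (Suc n)})"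
    using assms(1) by (intro card_Un_disjoint) (auto intro: finite_subset)
  moreover have "card ((\<lambda>r. (r, l r)) ` E) = card E"
    by (rule card_image) (auto simp: inj_on_def)
  ultimately show ?thesis by (simp add: card_cartesian_product_singleton)
qed

text \<open>Lowering by one can reverse an inequality only between equal values, when the upper one
  is kept and the lower one drops or vice versa; the harmful case, \<open>i\<close> lowered and a
  later \<open>j\<close> kept, is excluded by closure.\<close>

lemma lower_antimono:
  assumes l: "antimono_on {1..Suc n} l" and E: "bottom_closed {1..n} l E"
  shows "antimono_on {1..n} (lower l E)"
proof (rule monotone_onI)
  fix i j assume ij: "i \<in> {1..n}" "j \<in> {1..n}" "i \<le> j"
  then have "l j \<le> l i" using monotone_onD[OF l, of i j] by auto
  moreover have "j \<in> E" if "i \<in> E" "l i = l j"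
    using E that ij unfolding bottom_closed_def by (metis le_neq_implies_less)
  ultimately show "lower l E i \<ge> lower l E j" by (cases "l i = l j") (auto simp: lower_def)
qed

text \<open>In a row \<open>r \<le> n\<close> the entries at least \<open>r\<close> increase
  strictly, so \<open>n\<close> occurs at most once, at the end; row \<open>Suc n\<close> consists
  of entries \<open>n\<close> only. Hence the other boxes form the diagram of
  \<open>lower l E\<close>. The number of entries \<open>n\<close> gives removability, and monotone
  columns give closure.\<close>

lemma drop_last_tableau:
  assumes l: "antimono_on {1..Suc n} l" and t: "t \<in> spin_tableaux (Suc n) l"
  defines "E \<equiv> last_rows n l t"
  shows "boxes n (lower l E) = {b \<in> boxes (Suc n) l. t b \<noteq> n}" (is ?boxes)
    and "E \<in> removable n l"
    and "bottom_closed {1..n} l E"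
    and "drop_last n t \<in> spin_tableaux n (lower l E)"
    and "add_last n l E (drop_last n t) = t"
proof -
  have out: "\<And>b. b \<notin> boxes (Suc n) l \<Longrightarrow> t b = 0"
    and rng: "\<And>b. b \<in> boxes (Suc n) l \<Longrightarrow> t b \<in> {1..n}"
    and cnt: "\<And>i. i \<in> {1..n} \<Longrightarrow> card {b \<in> boxes (Suc n) l. t b = i} = i"
    and row: "\<And>r c. (r, c) \<in> boxes (Suc n) l \<Longrightarrow> r \<le> t (r, c) + 1"
    and rows: "\<And>r c c'. (r, c) \<in> boxes (Suc n) l \<Longrightarrow> (r, c') \<in> boxes (Suc n) l \<Longrightarrow> c < c' \<Longrightarrow> t (r, c) \<le> t (r, c')"
    and cols: "\<And>r r' c. (r, c) \<in> boxes (Suc n) l \<Longrightarrow> (r', c) \<in> boxes (Suc n) l \<Longrightarrow> r < r' \<Longrightarrow> t (r, c) \<le> t (r', c)"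
    and strict: "\<And>r c c'. (r, c) \<in> boxes (Suc n) l \<Longrightarrow> (r, c') \<in> boxes (Suc n) l \<Longrightarrow> c < c'
      \<Longrightarrow> r \<le> t (r, c) \<Longrightarrow> r \<le> t (r, c') \<Longrightarrow> t (r, c) < t (r, c')"
    using t unfolding spin_tableaux_def mem_Collect_eq diff_Suc_1 by blast+
  have E: "E \<subseteq> {1..n}" "\<forall>i\<in>E. l i > 0"
    by (auto simp: E_def last_rows_def)
  have "(r, c) \<in> boxes n (lower l E) \<longleftrightarrow> t (r, c) \<noteq> n" if b: "(r, c) \<in> boxes (Suc n) l" for r c
  proof (cases "r = Suc n")
    case True
    then have "t (r, c) = n" using row[OF b] rng[OF b] by auto
    then show ?thesis using True by (auto simp: boxes_def)
  next
    case False
    then have r: "r \<in> {1..n}" "c \<in> {1..l r}" using b by (auto simp: boxes_def)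
    show ?thesis
    proof (cases "c = l r")
      case True
      then show ?thesis using r by (auto simp: boxes_def lower_def E_def last_rows_def)
    next
      case c: False
      then have last: "(r, l r) \<in> boxes (Suc n) l" "c < l r" using r by (auto simp: boxes_def)
      \<comment> \<open>Otherwise the last box of the row would also have entry \<open>n\<close>,
        against strict increase, since \<open>r \<le> n\<close>.\<close>
      have "t (r, c) \<noteq> n"
        using rows[OF b last] strict[OF b last] rng[OF last(1)] r by auto
      then show ?thesis using r last by (auto simp: boxes_def lower_def)
    qed
  qed
  moreover have "boxes n (lower l E) \<subseteq> boxes (Suc n) l" using boxes_lower(1)[OF E] by blast
  ultimately show boxes: ?boxes by auto
  have "card (boxes (Suc n) l - boxes n (lower l E)) = n"
  \<comment> \<open>The prescribed number of entries is available only for entries from 1 on; for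
    \<open>n = 0\<close> no entry is allowed and the diagram is empty.\<close>
  proof (cases "n = 0")
    case True
    then have "boxes (Suc n) l = {}" using rng by fastforce
    then show ?thesis using True by simp
  next
    case False
    moreover have "boxes (Suc n) l - boxes n (lower l E) = {b \<in> boxes (Suc n) l. t b = n}"
      unfolding boxes by blast
    ultimately show ?thesis using cnt[of n] by simp
  qed
  then show rem: "E \<in> removable n l"
    using E card_boxes_last[OF E] by (auto simp: removable_def)
  show bot: "bottom_closed {1..n} l E"
    unfolding bottom_closed_def
  proof (intro ballI impI)
    fix i j assume ij: "i \<in> E" "j \<in> {1..n}" "i < j \<and> l i = l j"
    have b: "(i, l i) \<in> boxes (Suc n) l" "(j, l i) \<in> boxes (Suc n) l"
      using E ij by (force simp: boxes_def)+
    have "t (i, l i) = n" "l i > 0" using ij(1) by (simp_all add: E_def last_rows_def)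
    moreover from this have "t (j, l i) = n" using cols[OF b] rng[OF b(2)] ij(3) by simp
    ultimately show "j \<in> E" using ij(2,3) by (simp add: E_def last_rows_def)
  qed
  let ?t = "drop_last n t"
  have old: "b \<in> boxes n (lower l E) \<Longrightarrow> b \<in> boxes (Suc n) l \<and> t b \<noteq> n \<and> ?t b = t b" for b
    unfolding boxes by (simp add: drop_last_def)
  show "?t \<in> spin_tableaux n (lower l E)"
    unfolding spin_tableaux_def mem_Collect_eq
  proof (intro conjI allI impI ballI)
    show "?t b = 0" if "b \<notin> boxes n (lower l E)" for b
      using that out[of b] unfolding boxes by (auto simp: drop_last_def)
    show "?t b \<in> {1..n - 1}" if "b \<in> boxes n (lower l E)" for b
      using old[OF that] rng[of b] by auto
    fix i assume i: "i \<in> {1..n - 1}"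
    have "{b \<in> boxes n (lower l E). ?t b = i} = {b \<in> boxes (Suc n) l. t b = i}"
      using i unfolding boxes by (auto simp: drop_last_def)
    then show "card {b \<in> boxes n (lower l E). ?t b = i} = i" using cnt[of i] i by auto
    show "r \<le> i + 1" if "(r, c) \<in> boxes n (lower l E) \<and> ?t (r, c) = i" for r c
      using old[of "(r, c)"] row[of r c] that by auto
  next
    fix r c c' assume "(r, c) \<in> boxes n (lower l E) \<and> (r, c') \<in> boxes n (lower l E) \<and> c < c'"
    then show "?t (r, c) \<le> ?t (r, c')"
      using old[of "(r, c)"] old[of "(r, c')"] rows by simp
  next
    fix r r' c assume "(r, c) \<in> boxes n (lower l E) \<and> (r', c) \<in> boxes n (lower l E) \<and> r < r'"
    then show "?t (r, c) \<le> ?t (r', c)"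
      using old[of "(r, c)"] old[of "(r', c)"] cols by simp
  next
    fix r c c' assume "(r, c) \<in> boxes n (lower l E) \<and> (r, c') \<in> boxes n (lower l E) \<and> c < c'
      \<and> r \<le> ?t (r, c) \<and> r \<le> ?t (r, c')"
    then show "?t (r, c) < ?t (r, c')"
      using old[of "(r, c)"] old[of "(r, c')"] strict by simp
  qed
  show "add_last n l E ?t = t"
    unfolding add_last_def boxes by (rule ext) (auto simp: drop_last_def out)
qed

text \<open>The entry \<open>n\<close> exceeds all entries of \<open>t\<close>, and the new boxes
  lie at the ends of rows and at the bottom of columns, so monotonicity survives. Each of the first
  \<open>n\<close> rows receives at most one new box, so strictness survives too.\<close>

lemma add_last_tableau:
  assumes l: "antimono_on {1..Suc n} l" and rem: "E \<in> removable n l"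
    and bot: "bottom_closed {1..n} l E" and t: "t \<in> spin_tableaux n (lower l E)"
  shows "add_last n l E t \<in> spin_tableaux (Suc n) l"
    and "last_rows n l (add_last n l E t) = E"
    and "drop_last n (add_last n l E t) = t"
proof -
  have E: "E \<subseteq> {1..n}" "\<forall>i\<in>E. l i > 0" "card E + l (Suc n) = n"
    using rem by (auto simp: removable_def)
  let ?B = "boxes n (lower l E)"
  let ?C = "boxes (Suc n) l"
  let ?t = "add_last n l E t"
  have out: "\<And>b. b \<notin> ?B \<Longrightarrow> t b = 0"
    and rng: "\<And>b. b \<in> ?B \<Longrightarrow> t b \<in> {1..n - 1}"
    and cnt: "\<And>i. i \<in> {1..n - 1} \<Longrightarrow> card {b \<in> ?B. t b = i} = i"
    and row: "\<And>r c. (r, c) \<in> ?B \<Longrightarrow> r \<le> t (r, c) + 1"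
    and rows: "\<And>r c c'. (r, c) \<in> ?B \<Longrightarrow> (r, c') \<in> ?B \<Longrightarrow> c < c' \<Longrightarrow> t (r, c) \<le> t (r, c')"
    and cols: "\<And>r r' c. (r, c) \<in> ?B \<Longrightarrow> (r', c) \<in> ?B \<Longrightarrow> r < r' \<Longrightarrow> t (r, c) \<le> t (r', c)"
    and strict: "\<And>r c c'. (r, c) \<in> ?B \<Longrightarrow> (r, c') \<in> ?B \<Longrightarrow> c < c'
      \<Longrightarrow> r \<le> t (r, c) \<Longrightarrow> r \<le> t (r, c') \<Longrightarrow> t (r, c) < t (r, c')"
    using t unfolding spin_tableaux_def mem_Collect_eq by blast+
  have BC: "?B \<subseteq> ?C" using boxes_lower(1)[OF E(1,2)] by blast
  have card: "card (?C - ?B) = n" using card_boxes_last[OF E(1,2)] E(3) by simp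
  have old: "?t b = t b" "?t b < n" "?t b > 0" if "b \<in> ?B" for b
    using that rng[OF that] by (auto simp: add_last_def)
  have new: "?t b = n" "n > 0" if "b \<in> ?C" "b \<notin> ?B" for b
  proof -
    show "?t b = n" using that by (simp add: add_last_def)
    show "n > 0" using card that by (metis DiffI card_gt_0_iff empty_iff finite_Diff finite_boxes)
  qed
  have le: "?t b \<le> n" if "b \<in> ?C" for b
    using that old(2)[of b] new(1)[of b] by (cases "b \<in> ?B") auto
  have left: "(r, c) \<in> ?B" if "(r, c') \<in> ?B" "(r, c) \<in> ?C" "c < c'" for r c c'
    using that by (auto simp: boxes_def)
  \<comment> \<open>Here closure of \<open>E\<close> is used: the smaller shape is again a Young
    diagram, so no new box lies above an old one.\<close>
  have up: "(r, c) \<in> ?B" if "(r', c) \<in> ?B" "(r, c) \<in> ?C" "r < r'" for r r' c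
    using that monotone_onD[OF lower_antimono[OF l bot], of r r'] by (auto simp: boxes_def)
  have strip: "r = Suc n \<or> c = l r \<and> r \<in> E" if "(r, c) \<in> ?C" "(r, c) \<notin> ?B" for r c
    using that boxes_lower(1)[OF E(1,2)] by auto
  show "?t \<in> spin_tableaux (Suc n) l"
    unfolding spin_tableaux_def mem_Collect_eq diff_Suc_1
  proof (intro conjI allI impI ballI)
    show "?t b = 0" if "b \<notin> ?C" for b
      using that BC by (auto simp: add_last_def)
    show "?t b \<in> {1..n}" if b: "b \<in> ?C" for b
    proof (cases "b \<in> ?B")
      case True
      then show ?thesis using old(2,3)[of b] by simp
    next
      case False
      then show ?thesis using new[OF b] by simp
    qed
    fix i assume i: "i \<in> {1..n}"
    show "card {b \<in> ?C. ?t b = i} = i"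
    proof (cases "i = n")
      case True
      have "b \<in> ?C \<and> ?t b = n \<longleftrightarrow> b \<in> ?C - ?B" for b
        using old(2)[of b] new(1)[of b] by auto
      then have "{b \<in> ?C. ?t b = i} = ?C - ?B" using True by blast
      then show ?thesis using card True by simp
    next
      case False
      have "b \<in> ?C \<and> ?t b = i \<longleftrightarrow> b \<in> ?B \<and> t b = i" for b
        using old(1)[of b] new(1)[of b] False BC by (cases "b \<in> ?B") auto
      then have "{b \<in> ?C. ?t b = i} = {b \<in> ?B. t b = i}" by simp
      moreover have "i \<in> {1..n - 1}" using False i by auto
      ultimately show ?thesis using cnt[of i] by simp
    qed
    show "r \<le> i + 1" if "(r, c) \<in> ?C \<and> ?t (r, c) = i" for r c
    proof (cases "(r, c) \<in> ?B")
      case True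
      then show ?thesis using old(1)[OF True] row[OF True] that by simp
    next
      case False
      then show ?thesis using new(1)[of "(r, c)"] that by (auto simp: boxes_def)
    qed
  next
    fix r c c' assume a: "(r, c) \<in> ?C \<and> (r, c') \<in> ?C \<and> c < c'"
    show "?t (r, c) \<le> ?t (r, c')"
    proof (cases "(r, c') \<in> ?B")
      case True
      then have "(r, c) \<in> ?B" using left a by blast
      then show ?thesis using rows[OF _ True] old(1) True a by simp
    next
      case False
      then show ?thesis using new(1)[of "(r, c')"] le[of "(r, c)"] a by simp
    qed
  next
    fix r r' c assume a: "(r, c) \<in> ?C \<and> (r', c) \<in> ?C \<and> r < r'"
    show "?t (r, c) \<le> ?t (r', c)"
    proof (cases "(r', c) \<in> ?B")
      case True
      then have "(r, c) \<in> ?B" using up a by blast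
      then show ?thesis using cols[OF _ True] old(1) True a by simp
    next
      case False
      then show ?thesis using new(1)[of "(r', c)"] le[of "(r, c)"] a by simp
    qed
  next
    fix r c c' assume a: "(r, c) \<in> ?C \<and> (r, c') \<in> ?C \<and> c < c' \<and> r \<le> ?t (r, c) \<and> r \<le> ?t (r, c')"
    \<comment> \<open>The strictness condition concerns entries at least \<open>r\<close>; this
      excludes row \<open>Suc n\<close>, where the entry \<open>n\<close> may repeat.\<close>
    then have r: "r \<le> n" using le[of "(r, c)"] by simp
    have c: "(r, c) \<in> ?B"
    proof (rule ccontr)
      assume "(r, c) \<notin> ?B"
      then have "c = l r" using strip a r by fastforce
      then show False using a by (auto simp: boxes_def)
    qed
    show "?t (r, c) < ?t (r, c')"
    proof (cases "(r, c') \<in> ?B")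
      case True
      then show ?thesis using strict[OF c True] old(1) c a by simp
    next
      case False
      then show ?thesis using new(1)[of "(r, c')"] old(2)[OF c] a by simp
    qed
  qed
  show "last_rows n l ?t = E"
  proof -
    have "r \<in> last_rows n l ?t \<longleftrightarrow> r \<in> E" for r
    proof (cases "r \<in> {1..n} \<and> l r > 0")
      case True
      then have C: "(r, l r) \<in> ?C" by (auto simp: boxes_def)
      have "(r, l r) \<in> ?B \<longleftrightarrow> r \<notin> E" using True by (auto simp: boxes_def lower_def)
      then show ?thesis
        using True C old(2)[of "(r, l r)"] new(1)[of "(r, l r)"] by (auto simp: last_rows_def)
    next
      case False
      then show ?thesis using E by (auto simp: last_rows_def)
    qed
    then show ?thesis by blast
  qed
  show "drop_last n ?t = t"
  proof
    fix b
    show "drop_last n ?t b = t b"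
    proof (cases "b \<in> ?B")
      case True
      then show ?thesis using old[of b] by (simp add: drop_last_def)
    next
      case False
      then show ?thesis using out by (simp add: drop_last_def add_last_def)
    qed
  qed
qed

section \<open>The recursion for the weighted count of spin tableaux\<close>

text \<open>Factors of entries below \<open>n\<close> do not change. The factors of the entry
  \<open>n\<close> are the binomial coefficients in \<open>num_tournaments_Suc\<close>, column
  \<open>j\<close> corresponding to level \<open>j\<close>.\<close>

lemma tab_N_add_last:
  assumes l: "antimono_on {1..Suc n} l" and rem: "E \<in> removable n l"
    and bot: "bottom_closed {1..n} l E" and t: "t \<in> spin_tableaux n (lower l E)"
    and M: "\<And>i. i \<in> {1..Suc n} \<Longrightarrow> l i \<le> M"
  shows "tab_N (Suc n) l (add_last n l E t) =
    (\<Prod>c=1..M. card {i \<in> {1..n}. l i = c} choose card {i \<in> E. l i = c}) * tab_N n (lower l E) t"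
proof -
  have E: "E \<subseteq> {1..n}" "\<forall>i\<in>E. l i > 0" "card E + l (Suc n) = n"
    using rem by (auto simp: removable_def)
  let ?B = "boxes n (lower l E)"
  let ?C = "boxes (Suc n) l"
  let ?t = "add_last n l E t"
  have rng: "t b \<in> {1..n - 1}" if "b \<in> ?B" for b
    using t that unfolding spin_tableaux_def mem_Collect_eq by blast
  have BC: "?B \<subseteq> ?C" using boxes_lower(1)[OF E(1,2)] by blast
  have old: "?t b = t b" "?t b < n" if "b \<in> ?B" for b
    using that rng[OF that] by (auto simp: add_last_def)
  have new: "?t b = n" if "b \<in> ?C" "b \<notin> ?B" for b
    using that by (simp add: add_last_def)
  have less: "b \<in> ?C \<and> ?t b < i \<longleftrightarrow> b \<in> ?B \<and> t b < i" if "i \<le> n" for b i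
    using old[of b] new[of b] BC that by (cases "b \<in> ?B") auto
  have eq: "b \<in> ?C \<and> ?t b = i \<longleftrightarrow> b \<in> ?B \<and> t b = i" if "i < n" for b i
    using old[of b] new[of b] BC that by (cases "b \<in> ?B") auto
  \<comment> \<open>A new right neighbor has entry \<open>n > i\<close>, which counts in
    \<open>tab_a\<close> just like a missing neighbor.\<close>
  have gt: "(b \<in> ?C \<longrightarrow> i < ?t b) \<longleftrightarrow> (b \<in> ?B \<longrightarrow> i < t b)" if "i < n" for b i
    using old[of b] new[of b] BC that by (cases "b \<in> ?B") auto
  have b: "tab_b (Suc n) l ?t i j = tab_b n (lower l E) t i j" if "i < n" for i j
    unfolding tab_b_def eq[OF that] ..
  have a: "tab_a (Suc n) l ?t i j = tab_a n (lower l E) t i j" if "i < n" for i j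
    using less[of i] gt[of i] that unfolding tab_a_def b[OF that] conj_assoc[symmetric] by simp
  \<comment> \<open>The restriction to the first \<open>n\<close> boxes of the column discards row
    \<open>Suc n\<close>; what remains are the new boxes at the ends of the rows in
    \<open>E\<close>.\<close>
  have bn: "tab_b (Suc n) l ?t n j = card {i \<in> E. l i = j}" if "1 \<le> j" for j
  proof -
    have "r \<le> n \<and> (r, j) \<in> ?C \<and> ?t (r, j) = n \<longleftrightarrow> r \<in> E \<and> l r = j" for r
    proof
      assume r: "r \<le> n \<and> (r, j) \<in> ?C \<and> ?t (r, j) = n"
      then have "(r, j) \<notin> ?B" using old(2)[of "(r, j)"] by auto
      then show "r \<in> E \<and> l r = j" using r boxes_lower(1)[OF E(1,2)] by auto
    next
      assume r: "r \<in> E \<and> l r = j"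
      then have "(r, j) \<in> ?C" "(r, j) \<notin> ?B" using boxes_lower(1,2)[OF E(1,2)] by blast+
      then show "r \<le> n \<and> (r, j) \<in> ?C \<and> ?t (r, j) = n" using new r E(1) by auto
    qed
    then show ?thesis by (simp add: tab_b_def)
  qed
  \<comment> \<open>No entry exceeds \<open>n\<close>, so the additional boxes have no right
    neighbor. They end rows of length \<open>j\<close> and have entries below \<open>n\<close>, so
    their rows are those outside \<open>E\<close>.\<close>
  have an: "tab_a (Suc n) l ?t n j = card {i \<in> {1..n}. l i = j}" if "1 \<le> j" for j
  proof -
    have "(r, j) \<in> ?C \<and> ?t (r, j) < n \<and> ((r, j + 1) \<in> ?C \<longrightarrow> ?t (r, j + 1) > n)
      \<longleftrightarrow> r \<in> {1..n} \<and> r \<notin> E \<and> l r = j" for r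
    proof -
      have "\<not> ?t b > n" if "b \<in> ?C" for b
        using that old(2)[of b] new[of b] by (cases "b \<in> ?B") auto
      moreover have "(r, j) \<in> ?C \<and> ?t (r, j) < n \<longleftrightarrow> (r, j) \<in> ?B"
        using less[of n "(r, j)"] rng[of "(r, j)"] by auto
      ultimately have "(r, j) \<in> ?C \<and> ?t (r, j) < n \<and> ((r, j + 1) \<in> ?C \<longrightarrow> ?t (r, j + 1) > n)
        \<longleftrightarrow> (r, j) \<in> ?B \<and> (r, j + 1) \<notin> ?C" by blast
      also have "\<dots> \<longleftrightarrow> r \<in> {1..n} \<and> r \<notin> E \<and> l r = j"
        using that by (auto simp: boxes_def lower_def split: if_splits)
      finally show ?thesis .
    qed
    then have "tab_a (Suc n) l ?t n j = card {i \<in> E. l i = j} + card {r \<in> {1..n}. r \<notin> E \<and> l r = j}"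
      by (simp add: tab_a_def bn[OF that])
    also have "\<dots> = card ({i \<in> E. l i = j} \<union> {r \<in> {1..n}. r \<notin> E \<and> l r = j})"
      using E(1) by (intro card_Un_disjoint[symmetric]) (auto intro: finite_subset)
    also have "{i \<in> E. l i = j} \<union> {r \<in> {1..n}. r \<notin> E \<and> l r = j} = {i \<in> {1..n}. l i = j}"
      using E(1) by auto
    finally show ?thesis .
  qed
  have lowerM: "lower l E i \<le> M" if "i \<in> {1..n}" for i
    using M[of i] that by (simp add: lower_def)
  let ?P = "\<lambda>i. \<Prod>j=1..M. tab_a (Suc n) l ?t i j choose tab_b (Suc n) l ?t i j"
  have N: "tab_N (Suc n) l ?t = (\<Prod>i=1..n. ?P i)"
    using tab_N_eq[OF add_last_tableau(1)[OF l rem bot t] M] by simp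
  have N': "tab_N n (lower l E) t = (\<Prod>i=1..n - 1. ?P i)"
  proof -
    have "tab_a (Suc n) l ?t i j choose tab_b (Suc n) l ?t i j
      = tab_a n (lower l E) t i j choose tab_b n (lower l E) t i j" if "i \<in> {1..n - 1}" for i j
    proof -
      have "i < n" using that by auto
      then show ?thesis by (simp only: a b)
    qed
    then show ?thesis using tab_N_eq[OF t lowerM] by simp
  qed
  have Pn: "?P n = (\<Prod>c=1..M. card {i \<in> {1..n}. l i = c} choose card {i \<in> E. l i = c})"
    by (intro prod.cong refl) (simp add: an bn)
  show ?thesis
  proof (cases "n = 0")
    case True
    then show ?thesis using N N' E(1) by simp
  next
    case False
    then have "{1..n} = insert n {1..n - 1}" by auto
    then have "(\<Prod>i=1..n. ?P i) = ?P n * (\<Prod>i=1..n - 1. ?P i)" using False by simp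
    then show ?thesis using N N' Pn by simp
  qed
qed

text \<open>Removing the entries \<open>n\<close> is a bijection from tableaux to pairs of a set
  \<open>E\<close> and a tableau of shape \<open>lower l E\<close>. The resulting recursion has the
  same coefficients as \<open>num_tournaments_Suc\<close>.\<close>

lemma sum_tab_N_Suc:
  assumes l: "antimono_on {1..Suc n} l" and M: "\<And>i. i \<in> {1..Suc n} \<Longrightarrow> l i \<le> M"
  shows "(\<Sum>t\<in>spin_tableaux (Suc n) l. tab_N (Suc n) l t) =
    (\<Sum>E | E \<in> removable n l \<and> bottom_closed {1..n} l E.
       (\<Prod>c=1..M. card {i \<in> {1..n}. l i = c} choose card {i \<in> E. l i = c})
       * (\<Sum>t\<in>spin_tableaux n (lower l E). tab_N n (lower l E) t))"
proof -
  let ?C = "{E. E \<in> removable n l \<and> bottom_closed {1..n} l E}"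
  let ?T = "\<lambda>E. spin_tableaux n (lower l E)"
  let ?m = "\<lambda>E. \<Prod>c=1..M. card {i \<in> {1..n}. l i = c} choose card {i \<in> E. l i = c}"
  have N: "?m (last_rows n l t) * tab_N n (lower l (last_rows n l t)) (drop_last n t) = tab_N (Suc n) l t"
    if t: "t \<in> spin_tableaux (Suc n) l" for t
    using tab_N_add_last[OF l drop_last_tableau(2-4)[OF l t] M] drop_last_tableau(5)[OF l t] by simp
  have "(\<Sum>t\<in>spin_tableaux (Suc n) l. tab_N (Suc n) l t)
    = (\<Sum>(E, t)\<in>Sigma ?C ?T. ?m E * tab_N n (lower l E) t)"
  proof (rule sum.reindex_bij_witness[where j = "\<lambda>t. (last_rows n l t, drop_last n t)"
        and i = "\<lambda>(E, t). add_last n l E t"])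
    fix t assume t: "t \<in> spin_tableaux (Suc n) l"
    show "(case (last_rows n l t, drop_last n t) of (E, t) \<Rightarrow> add_last n l E t) = t"
      "(last_rows n l t, drop_last n t) \<in> Sigma ?C ?T"
      using drop_last_tableau(2-5)[OF l t] by auto
    show "(case (last_rows n l t, drop_last n t) of (E, t) \<Rightarrow> ?m E * tab_N n (lower l E) t) = tab_N (Suc n) l t"
      using N[OF t] by simp
  qed (use add_last_tableau[OF l] in auto)
  also have "\<dots> = (\<Sum>E\<in>?C. \<Sum>t\<in>?T E. ?m E * tab_N n (lower l E) t)"
    by (rule sum.Sigma[symmetric]) (auto simp: finite_spin_tableaux finite_removable)
  finally show ?thesis by (simp add: sum_distrib_left)
qed

text \<open>Both sides satisfy the same recursion. Being antitone passes from \<open>l\<close> to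
  \<open>lower l E\<close>, so the induction runs over all antitone sequences.\<close>

theorem num_tournaments_eq_sum_tab_N:
  assumes "antimono_on {1..n} l"
  shows "num_tournaments {1..n} l = (\<Sum>t\<in>spin_tableaux n l. tab_N n l t)"
  using assms
proof (induction n arbitrary: l)
  case 0
  have "spin_tableaux 0 l = {\<lambda>b. 0}" by (auto simp: spin_tableaux_def boxes_def)
  moreover have "tab_N 0 l t = 1" for t by (simp add: tab_N_def boxes_def)
  moreover have "tournaments ({} :: nat set) = {{}}" by (auto simp: tournaments_def)
  ultimately show ?case by (simp add: num_tournaments_def)
next
  case (Suc n)
  have M: "l i \<le> l 1" if "i \<in> {1..Suc n}" for i
    using monotone_onD[OF Suc.prems, of 1 i] that by simp
  have "num_tournaments {1..n} (lower l E) = (\<Sum>t\<in>spin_tableaux n (lower l E). tab_N n (lower l E) t)"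
    if "bottom_closed {1..n} l E" for E
    using Suc.IH lower_antimono[OF Suc.prems that] .
  then show ?case
    using num_tournaments_Suc[of n l "l 1"] sum_tab_N_Suc[OF Suc.prems, of "l 1"] M by simp
qed

section \<open>Weights of the spin module as scores\<close>

definition dominance :: "nat \<Rightarrow> (nat \<times> nat) set \<Rightarrow> (nat \<times> nat) set" where
  "dominance n A = (pos_roots n - A) \<union> A\<inverse>"

text \<open>For each pair \<open>i < j\<close> exactly one of \<open>(i, j)\<close> and
  \<open>(j, i)\<close> lies in a tournament, so \<open>A\<close> is recovered as the set of
  positive roots outside it.\<close>

lemma dominance_bij: "bij_betw (dominance n) (Pow (pos_roots n)) (tournaments {..<n})"
proof (rule bij_betw_byWitness[where f' = "\<lambda>W. pos_roots n - W"])
  show "\<forall>A\<in>Pow (pos_roots n). pos_roots n - dominance n A = A"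
  proof
    fix A assume "A \<in> Pow (pos_roots n)"
    then have A: "i < j \<and> j < n" if "(i, j) \<in> A" for i j
      using that by (auto simp: pos_roots_def)
    have "(i, j) \<in> pos_roots n - dominance n A \<longleftrightarrow> (i, j) \<in> A" for i j
      using A[of i j] A[of j i] by (auto simp: dominance_def pos_roots_def)
    then show "pos_roots n - dominance n A = A" by auto
  qed
  show "\<forall>W\<in>tournaments {..<n}. dominance n (pos_roots n - W) = W"
  proof
    fix W assume W: "W \<in> tournaments {..<n}"
    have "(i, j) \<in> dominance n (pos_roots n - W) \<longleftrightarrow> (i, j) \<in> W" for i j
    proof (cases "i < n \<and> j < n")
      case True
      then show ?thesis
        using tournaments_iff[OF W, of i j] by (cases i j rule: linorder_cases) (auto simp: dominance_def pos_roots_def)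
    next
      case False
      then show ?thesis using tournaments_subset[OF W] by (auto simp: dominance_def pos_roots_def)
    qed
    then show "dominance n (pos_roots n - W) = W" by auto
  qed
  show "dominance n ` Pow (pos_roots n) \<subseteq> tournaments {..<n}"
  proof (rule image_subsetI)
    fix A assume "A \<in> Pow (pos_roots n)"
    then have A: "i < j \<and> j < n" if "(i, j) \<in> A" for i j
      using that by (auto simp: pos_roots_def)
    show "dominance n A \<in> tournaments {..<n}"
      unfolding tournaments_def mem_Collect_eq
    proof (intro conjI ballI)
      fix i j assume "i \<in> {..<n}" "j \<in> {..<n}"
      then show "(i, j) \<in> dominance n A \<longleftrightarrow> i \<noteq> j \<and> (j, i) \<notin> dominance n A"
        by (cases i j rule: linorder_cases) (auto simp: dominance_def pos_roots_def dest: A)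
    qed (auto simp: dominance_def pos_roots_def dest: A)
  qed
qed auto

section \<open>Sums over winners and losers\<close>

text \<open>Every player takes part in \<open>n - 1\<close> games, once for each opponent, as winner
  or as loser.\<close>

lemma tournament_sum_losers:
  fixes h :: "nat \<Rightarrow> 'a :: comm_ring_1"
  assumes W: "W \<in> tournaments {..<n}"
  shows "(\<Sum>(i, j)\<in>W. h i) + (\<Sum>(i, j)\<in>W. h j) = (of_nat n - 1) * (\<Sum>i<n. h i)"
proof -
  have fin: "finite W" using tournaments_subset[OF W] by (rule finite_subset) simp
  have "(\<Sum>(i, j)\<in>W. h j) = (\<Sum>(i, j)\<in>W\<inverse>. h i)"
    by (rule sum.reindex_bij_witness[where i = prod.swap and j = prod.swap]) auto
  moreover have "(\<Sum>(i, j)\<in>W. h i) + (\<Sum>(i, j)\<in>W\<inverse>. h i) = (\<Sum>(i, j)\<in>W \<union> W\<inverse>. h i)"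
    using fin tournaments_subset[OF W] tournaments_iff[OF W] by (intro sum.union_disjoint[symmetric]) auto
  moreover have "W \<union> W\<inverse> = (SIGMA i:{..<n}. {..<n} - {i})"
    using tournaments_subset[OF W] tournaments_iff[OF W] by blast
  moreover have "(\<Sum>(i, j)\<in>(SIGMA i:{..<n}. {..<n} - {i}). h i) = (\<Sum>i<n. \<Sum>j\<in>{..<n} - {i}. h i)"
    by (subst sum.Sigma) auto
  moreover have "(\<Sum>i<n. \<Sum>j\<in>{..<n} - {i}. h i) = (\<Sum>i<n. (of_nat n - 1) * h i)"
    by (rule sum.cong) (auto simp: of_nat_diff)
  ultimately show ?thesis by (simp add: sum_distrib_left)
qed

lemma tournament_sum_winners:
  fixes h :: "nat \<Rightarrow> 'a :: comm_semiring_1"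
  assumes W: "W \<in> tournaments {..<n}"
  shows "(\<Sum>(i, j)\<in>W. h i) = (\<Sum>i<n. of_nat (card (W `` {i})) * h i)"
proof -
  have fin: "finite W" using tournaments_subset[OF W] by (rule finite_subset) simp
  have "W = (SIGMA i:{..<n}. W `` {i})" using tournaments_subset[OF W] by auto
  then have "(\<Sum>(i, j)\<in>W. h i) = (\<Sum>(i, j)\<in>(SIGMA i:{..<n}. W `` {i}). h i)" by simp
  also have "\<dots> = (\<Sum>i<n. \<Sum>j\<in>W `` {i}. h i)"
    by (rule sum.Sigma[symmetric]) (use fin in \<open>auto intro: finite_Image\<close>)
  finally show ?thesis by simp
qed

text \<open>Taking \<open>h\<close> constantly 1 in the two preceding lemmas counts the games twice
  and once.\<close>

lemma sum_scores:
  assumes W: "W \<in> tournaments {..<n}"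
  shows "(\<Sum>i<n. card (W `` {i})) = n choose 2"
proof -
  have "2 * int (card W) = (int n - 1) * int n"
    using tournament_sum_losers[OF W, of "\<lambda>_. 1 :: int"] by (simp add: case_prod_unfold)
  then have "2 * int (card W) = int (n * (n - 1))"
    by (cases n) (simp_all add: algebra_simps)
  then have "2 * card W = n * (n - 1)" by linarith
  then have "card W = n choose 2" unfolding choose_two by simp
  moreover have "card W = (\<Sum>i<n. card (W `` {i}))"
    using tournament_sum_winners[OF W, of "\<lambda>_. 1 :: nat"] by (simp add: case_prod_unfold)
  ultimately show ?thesis by simp
qed

text \<open>Twice the weight is the sum over all games of the winner's diagonal entry minus the
  loser's. As the trace vanishes, the losers' sum is the negative of the winners' sum, which cancels
  the factor 1/2.\<close>

lemma spin_weight_dominance: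
  assumes A: "A \<subseteq> pos_roots n" and H: "H \<in> cartan n"
  shows "spin_weight n A H = (\<Sum>i<n. of_nat (card (dominance n A `` {i})) * H $$ (i, i))"
proof -
  let ?W = "dominance n A"
  let ?h = "\<lambda>i. H $$ (i, i)"
  have W: "?W \<in> tournaments {..<n}"
    using dominance_bij[of n] A by (auto simp: bij_betw_def)
  have finA: "finite A" using A finite_pos_roots finite_subset by blast
  have "(\<Sum>(i, j)\<in>?W. ?h i - ?h j) = (\<Sum>(i, j)\<in>pos_roots n - A. ?h i - ?h j) + (\<Sum>(i, j)\<in>A\<inverse>. ?h i - ?h j)"
    unfolding dominance_def
    by (rule sum.union_disjoint) (use A finA finite_pos_roots in \<open>auto simp: pos_roots_def\<close>)
  also have "(\<Sum>(i, j)\<in>A\<inverse>. ?h i - ?h j) = (\<Sum>(i, j)\<in>A. ?h j - ?h i)"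
    by (rule sum.reindex_bij_witness[where i = prod.swap and j = prod.swap]) auto
  also have "\<dots> = - (\<Sum>(i, j)\<in>A. ?h i - ?h j)"
    by (simp add: sum_negf[symmetric] case_prod_unfold)
  finally have "2 * spin_weight n A H = (\<Sum>(i, j)\<in>?W. ?h i - ?h j)"
    by (simp add: spin_weight_def root_val_def case_prod_unfold)
  also have "\<dots> = (\<Sum>(i, j)\<in>?W. ?h i) - (\<Sum>(i, j)\<in>?W. ?h j)"
    by (simp add: sum_subtractf case_prod_unfold)
  also have "\<dots> = 2 * (\<Sum>(i, j)\<in>?W. ?h i)"
  proof -
    have "(\<Sum>i<n. ?h i) = 0" using H by (auto simp: cartan_def sl_def)
    then have "(\<Sum>(i, j)\<in>?W. ?h i) + (\<Sum>(i, j)\<in>?W. ?h j) = 0"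
      using tournament_sum_losers[OF W, of ?h] by simp
    then show ?thesis by (simp add: eq_neg_iff_add_eq_0 algebra_simps)
  qed
  finally show ?thesis using tournament_sum_winners[OF W, of ?h] by simp
qed

section \<open>Comparing weights through their coefficients\<close>

text \<open>Summation by parts; the boundary term is a multiple of the trace
  \<open>fund_weight n H\<close>, which is zero.\<close>

lemma part_weight_eq:
  assumes n: "n \<ge> 1" and H: "H \<in> cartan n"
  shows "part_weight n l H = (\<Sum>i<n. of_nat (l (Suc i)) * H $$ (i, i))"
proof -
  have *: "(\<Sum>i=1..m. (of_nat (l i) - of_nat (l (i + 1))) * fund_weight i H)
    = (\<Sum>i<Suc m. of_nat (l (Suc i)) * H $$ (i, i)) - of_nat (l (Suc m)) * fund_weight (Suc m) H" for m
    by (induction m) (simp_all add: fund_weight_def algebra_simps)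
  obtain m where m: "n = Suc m" using n by (cases n) auto
  have "fund_weight n H = 0" using H by (auto simp: fund_weight_def cartan_def sl_def)
  then show ?thesis using *[of m] by (simp add: part_weight_def m)
qed

text \<open>On trace-zero diagonal matrices the coefficients are determined up to a common constant,
  and equal sums force this constant to be 0.\<close>

lemma cartan_functional_eq_iff:
  fixes f g :: "nat \<Rightarrow> nat"
  assumes sum: "(\<Sum>i<n. f i) = (\<Sum>i<n. g i)"
  shows "(\<forall>H\<in>cartan n. (\<Sum>i<n. of_nat (f i) * H $$ (i, i)) = (\<Sum>i<n. of_nat (g i) * H $$ (i, i)))
    \<longleftrightarrow> (\<forall>i<n. f i = g i)"
proof (intro iffI allI impI)
  fix k
  assume eq: "\<forall>H\<in>cartan n. (\<Sum>i<n. of_nat (f i) * H $$ (i, i)) = (\<Sum>i<n. of_nat (g i) * H $$ (i, i))"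
    and k: "k < n"
  define d where "d i = (of_nat (f i) - of_nat (g i) :: complex)" for i
  have "d m = d k" if m: "m < n" for m
  proof (cases "m = k")
    case False
    \<comment> \<open>The diagonal matrix with 1 at \<open>m\<close> and -1 at \<open>k\<close>
      compares the coefficients with these two indices.\<close>
    define H where "H = mat n n (\<lambda>(a, b). if a = b then (if a = m then 1 else if a = k then - 1 else 0) else (0 :: complex))"
    have sumH: "(\<Sum>a<n. c a * H $$ (a, a)) = c m - c k" for c :: "nat \<Rightarrow> complex"
    proof -
      have "(\<Sum>a<n. c a * H $$ (a, a)) = (\<Sum>a<n. (if a = m then c m else 0) - (if a = k then c k else 0))"
        by (rule sum.cong) (use False in \<open>auto simp: H_def\<close>)
      then show ?thesis using k m by (simp add: sum_subtractf)
    qed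
    have H: "H \<in> cartan n"
      using sumH[of "\<lambda>_. 1"] by (auto simp: cartan_def sl_def diagonal_mat_def H_def)
    have "of_nat (f m) - of_nat (f k) = (of_nat (g m) - of_nat (g k) :: complex)"
      using bspec[OF eq H] unfolding sumH .
    then show ?thesis by (simp add: d_def algebra_simps)
  qed simp
  then have "(\<Sum>i<n. d i) = of_nat n * d k" by simp
  moreover have "(\<Sum>i<n. d i) = 0"
    unfolding d_def sum_subtractf using sum by (simp flip: of_nat_sum)
  ultimately have "d k = 0" using k by simp
  then show "f k = g k" by (simp add: d_def)
qed auto

text \<open>The scores of a tournament and the parts of \<open>l\<close> have the same sum, so
  equality of weights on the Cartan subalgebra means equality of scores with parts.\<close>

lemma spin_mult_eq_num_tournaments:
  assumes n: "n \<ge> 1" and l: "(\<Sum>i=1..n. l i) = n choose 2"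
  shows "spin_mult n (part_weight n l) = num_tournaments {1..n} l"
proof -
  let ?\<A> = "{A \<in> Pow (pos_roots n). \<forall>i\<in>{..<n}. card (dominance n A `` {i}) = l (Suc i)}"
  have suml: "(\<Sum>i<n. l (Suc i)) = n choose 2"
    using l by (simp add: sum.atLeast1_atMost_eq)
  have "(\<forall>H\<in>cartan n. spin_weight n A H = part_weight n l H)
    \<longleftrightarrow> (\<forall>i\<in>{..<n}. card (dominance n A `` {i}) = l (Suc i))"
    if A: "A \<subseteq> pos_roots n" for A
  proof -
    have "dominance n A \<in> tournaments {..<n}"
      using dominance_bij[of n] A by (auto simp: bij_betw_def)
    then show ?thesis
      using sum_scores cartan_functional_eq_iff[where f = "\<lambda>i. card (dominance n A `` {i})" and g = "\<lambda>i. l (Suc i)" and n = n] by (simp add: suml spin_weight_dominance[OF A] part_weight_eq[OF n] Ball_def)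
  qed
  then have "spin_mult n (part_weight n l) = card ?\<A>"
    unfolding spin_mult_eq_card by (intro arg_cong[of _ _ card]) auto
  also have "\<dots> = num_tournaments {..<n} (l \<circ> Suc)"
    unfolding num_tournaments_def
  proof (rule bij_betw_same_card[of "dominance n"])
    show "bij_betw (dominance n) ?\<A> {W \<in> tournaments {..<n}. \<forall>i\<in>{..<n}. card (W `` {i}) = (l \<circ> Suc) i}"
    proof (rule bij_betw_subset[OF dominance_bij])
      show "dominance n ` ?\<A> = {W \<in> tournaments {..<n}. \<forall>i\<in>{..<n}. card (W `` {i}) = (l \<circ> Suc) i}"
        unfolding bij_betw_imp_surj_on[OF dominance_bij, symmetric] by auto
    qed auto
  qed
  also have "\<dots> = num_tournaments (Suc ` {..<n}) l"
    by (rule num_tournaments_image[symmetric]) simp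
  also have "Suc ` {..<n} = {1..n}" by (simp add: image_Suc_lessThan)
  finally show ?thesis .
qed

theorem theoremC:
  fixes n :: nat and l :: "nat \<Rightarrow> nat"
  assumes "n \<ge> 1" and "l \<in> spin_partitions n"
  shows "spin_mult n (part_weight n l) = (\<Sum>t\<in>spin_tableaux n l. tab_N n l t)"
proof -
  have "antimono_on {1..n} l" "(\<Sum>i=1..n. l i) = n choose 2"
    using assms(2) by (auto simp: spin_partitions_def monotone_on_def)
  then show ?thesis
    using spin_mult_eq_num_tournaments[OF assms(1)] num_tournaments_eq_sum_tab_N by simp
qed

end
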